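(* Let $A$ be an associative unital $\mathbb K$-algebra. The map $Sp^\ast:\overline{\mathcal L_{NC}(A)}\to\overline{\mathcal L_A}$, $Sp^\ast(f)=f\circ Sp$, is a morphism of unital shuffle algebras: $Sp^\ast(f\prec g)=Sp^\ast(f)\prec Sp^\ast(g)$ and $Sp^\ast(f\succ g)=Sp^\ast(f)\succ Sp^\ast(g)$ for all $f,g$, and $Sp^\ast(e)=e$.
   Context: $\mathbb K$ is a field of characteristic zero; $m_{\mathbb K}$ is its multiplication. Double tensor algebra: $T(A)=\bigoplus_{n\ge1}A^{\otimes n}$ (words $a_1\cdots a_n$); for $S=\{s_1<\dots<s_k\}\subseteq[n]=\{1,\dots,n\}$, $a_S=a_{s_1}\cdots a_{s_k}$, $a_\emptyset=\mathbf 1$. $\overline T(T(A))=\bigoplus_{k\ge0}T(A)^{\otimes k}$ (bar notation, concatenation, unit $\mathbf 1$), $T(T(A))$ the part $k\ge1$. Coproduct $\Delta(a_1\cdots a_n)=\sum_{S\subseteq[n]}a_S\otimes a_{J_1}|\cdots|a_{J_k}$ with $J_1,\dots,J_k$ the maximal sets of consecutive integers in $[n]\setminus S$ (empty bar word $=\mathbf 1$), extended multiplicatively; $\Delta^+_\prec$ is the sum over $S\ni1$, $\Delta^+_\succ$ over $S\not\ni1$; $\Delta_\prec(w)=\Delta^+_\prec(w)-w\otimes\mathbf 1$, $\Delta_\succ(w)=\Delta^+_\succ(w)-\mathbf 1\otimes w$, with $\Delta^+_\prec(w_1|\cdots|w_m)=\Delta^+_\prec(w_1)\Delta(w_2)\cdots\Delta(w_m)$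 and likewise for $\succ$. Decorated non-crossing partitions: a partition of a finite $S\subset\mathbb N$ is non-crossing if there are no $p_1<q_1<p_2<q_2$ in $S$ with $p_1,p_2$ in one block and $q_1,q_2$ in another; $NC_n$ is the set of non-crossing partitions of $[n]$, $\mathcal{NC}_n$ its span, $\mathcal{NC}(A)=\bigoplus_{n\ge1}\mathcal{NC}_n\otimes A^{\otimes n}$. For blocks $B,C$ of $L$, $B<_LC$ iff $\inf C<m<\sup C$ for all $m\in B$; $L=Q\sqcup U$ (parts possibly empty) is admissible if no $B\in Q$, $C\in U$ satisfy $B<_LC$; $J_1,\dots,J_k$ are then the maximal sets of consecutive integers in $[n]\setminus\bigcup Q$, $J_i^{L,Q}$ the partition of $J_i$ by the blocks of $U$ in it, $a_Q=a_{\bigcup Q}$, $a_{J_i^{L,Q}}=a_{J_i}$; $st$ is the increasing bijection of a finite set onto $[m]$, applied to partitions by transport. $\overline T(\mathcal{NC}(A))$ is the unital tensor algebra with coproduct $\Delta(L\otimes a_1\cdots a_n)=\sum_{L=Q\sqcup U\text{ adm}}(st(Q)\otimes a_Q)\otimes(st(J_1^{L,Q})\otimes a_{J_1^{L,Q}}|\cdots|st(J_k^{L,Q})\otimes a_{J_k^{L,Q}})$, extended multiplicatively; $\Delta^+_\prec$ (resp. $\Delta^+_\succ$) restricts the sum to decompositions where the block containing $1$ lies in $Q$ (resp. $U$), and $\Delta_\prec,\Delta_\succ$ are defined from them exactly as for $\overline T(T(A))$. Splitting map: $Sp(a_1\cdots a_n)=\sum_{L\in NC_n}L\otimes(a_1\cdots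 a_n)$, extended by $Sp(A_1|\cdots|A_k)=Sp(A_1)|\cdots|Sp(A_k)$, $Sp(\mathbf 1)=\mathbf 1$. For $H=T(T(A))$ or $T(\mathcal{NC}(A))$, $\overline{\mathcal L}:=\mathrm{Lin}(\overline H,\mathbb K)$ where $\overline H$ is the unital version, with half-convolutions $f\prec g=m_{\mathbb K}(f\otimes g)\Delta_\prec$, $f\succ g=m_{\mathbb K}(f\otimes g)\Delta_\succ$ on $H$; the unit $e$ is the map vanishing on $H$ and equal to the identity on the degree-zero part $\mathbb K$, with conventions $f\prec e=f=e\succ f$ and $e\prec f=0=f\succ e$ for $f$ vanishing on $\mathbb K\mathbf 1$. We write $\overline{\mathcal L_A}$ for $H=T(T(A))$ and $\overline{\mathcal L_{NC}(A)}$ for $H=T(\mathcal{NC}(A))$. *)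

theory Defs
  imports
    Complex_Main
    "HOL-Library.Poly_Mapping"
    "HOL-Library.Disjoint_Sets"
    "HOL-Library.FuncSet"
begin

section \<open>Unital associative algebras\<close>

text \<open>The sort \<open>{ring, monoid_mult}\<close> is that of unital associative rings without \<open>0 \<noteq> 1\<close>,
  so that the zero algebra is allowed.\<close>

locale unital_algebra = vector_space scale
  for scale :: "'k::field_char_0 \<Rightarrow> 'a::{ring, monoid_mult} \<Rightarrow> 'a" +
  assumes scale_mult_left: "scale c (x * y) = scale c x * y"
    and scale_mult_right: "scale c (x * y) = x * scale c y"


section \<open>Vector spaces given by generators and relations\<close>

text \<open>The free vector space on a set of generators consists of finitely supported functions;
  \<open>Poly_Mapping.single w 1\<close> is the generator \<open>w\<close>.\<close>

abbreviation gen :: "'w \<Rightarrow> ('w \<Rightarrow>\<^sub>0 'k::field_char_0)" where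
  "gen w \<equiv> Poly_Mapping.single w 1"

definition smul :: "'k::field_char_0 \<Rightarrow> ('w \<Rightarrow>\<^sub>0 'k) \<Rightarrow> ('w \<Rightarrow>\<^sub>0 'k)" where
  "smul c p = Poly_Mapping.map ((*) c) p"

lemma lookup_smul: "Poly_Mapping.lookup (smul c p) w = c * Poly_Mapping.lookup p w"
  by (simp add: smul_def Poly_Mapping.map.rep_eq when_def)

lemma vector_space_smul: "vector_space (smul :: 'k::field_char_0 \<Rightarrow> ('w \<Rightarrow>\<^sub>0 'k) \<Rightarrow> _)"
  by unfold_locales
    (auto intro!: poly_mapping_eqI simp: lookup_smul lookup_add algebra_simps)

definition lin_ext ::
    "('w \<Rightarrow> ('v \<Rightarrow>\<^sub>0 'k::field_char_0)) \<Rightarrow> ('w \<Rightarrow>\<^sub>0 'k) \<Rightarrow> ('v \<Rightarrow>\<^sub>0 'k)" where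
  "lin_ext \<phi> p = (\<Sum>w\<in>Poly_Mapping.keys p. smul (Poly_Mapping.lookup p w) (\<phi> w))"

definition bilin_ext ::
    "('u \<Rightarrow> 'v \<Rightarrow> 'w) \<Rightarrow> ('u \<Rightarrow>\<^sub>0 'k::field_char_0) \<Rightarrow> ('v \<Rightarrow>\<^sub>0 'k) \<Rightarrow> ('w \<Rightarrow>\<^sub>0 'k)" where
  "bilin_ext m p q = (\<Sum>x\<in>Poly_Mapping.keys p. \<Sum>y\<in>Poly_Mapping.keys q.
     Poly_Mapping.single (m x y) (Poly_Mapping.lookup p x * Poly_Mapping.lookup q y))"

text \<open>A presentation stands for the quotient of the free vector space on \<open>gens\<close> by the
  subspace spanned by \<open>rels\<close>; the elements of this quotient are the cosets collected in
  \<open>qspace\<close>.\<close>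

record (overloaded) ('w, 'k::zero) presentation =
  gens :: "'w set"
  rels :: "('w \<Rightarrow>\<^sub>0 'k) set"

definition free_on :: "'w set \<Rightarrow> ('w \<Rightarrow>\<^sub>0 'k::field_char_0) set" where
  "free_on W = {p. Poly_Mapping.keys p \<subseteq> W}"

definition coset :: "('w, 'k::field_char_0) presentation \<Rightarrow> ('w \<Rightarrow>\<^sub>0 'k) \<Rightarrow> ('w \<Rightarrow>\<^sub>0 'k) set" where
  "coset V p = {q. q - p \<in> module.span smul (rels V)}"

definition qspace :: "('w, 'k::field_char_0) presentation \<Rightarrow> ('w \<Rightarrow>\<^sub>0 'k) set set" where
  "qspace V = coset V ` free_on (gens V)"

definition rep :: "('w, 'k::field_char_0) presentation \<Rightarrow> ('w \<Rightarrow>\<^sub>0 'k) set \<Rightarrow> ('w \<Rightarrow>\<^sub>0 'k)" where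
  "rep V X = (SOME p. p \<in> free_on (gens V) \<and> coset V p = X)"

text \<open>The linear map of quotients induced by \<open>\<phi>\<close> on generators. It is independent of the choice
  of representatives as soon as \<open>lin_ext \<phi>\<close> maps \<open>rels V\<close> into the span of \<open>rels V'\<close>.\<close>

definition induced :: "('w, 'k::field_char_0) presentation \<Rightarrow> ('v, 'k) presentation \<Rightarrow>
    ('w \<Rightarrow> ('v \<Rightarrow>\<^sub>0 'k)) \<Rightarrow> ('w \<Rightarrow>\<^sub>0 'k) set \<Rightarrow> ('v \<Rightarrow>\<^sub>0 'k) set" where
  "induced V V' \<phi> = (\<lambda>X\<in>qspace V. coset V' (lin_ext \<phi> (rep V X)))"

text \<open>Linear functionals on the quotient, as functions that are \<open>undefined\<close> off \<open>qspace V\<close>,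
  so that equality of functionals is equality of functions.\<close>

definition Lin :: "('w, 'k::field_char_0) presentation \<Rightarrow> (('w \<Rightarrow>\<^sub>0 'k) set \<Rightarrow> 'k) set" where
  "Lin V = {f \<in> extensional (qspace V).
     (\<forall>p\<in>free_on (gens V). \<forall>q\<in>free_on (gens V).
        f (coset V (p + q)) = f (coset V p) + f (coset V q)) \<and>
     (\<forall>c. \<forall>p\<in>free_on (gens V). f (coset V (smul c p)) = c * f (coset V p))}"

definition lin_add :: "('w, 'k::field_char_0) presentation \<Rightarrow>
    (('w \<Rightarrow>\<^sub>0 'k) set \<Rightarrow> 'k) \<Rightarrow> (('w \<Rightarrow>\<^sub>0 'k) set \<Rightarrow> 'k) \<Rightarrow> (('w \<Rightarrow>\<^sub>0 'k) set \<Rightarrow> 'k)" where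
  "lin_add V f g = (\<lambda>X\<in>qspace V. f X + g X)"

definition lin_smul :: "('w, 'k::field_char_0) presentation \<Rightarrow>
    'k \<Rightarrow> (('w \<Rightarrow>\<^sub>0 'k) set \<Rightarrow> 'k) \<Rightarrow> (('w \<Rightarrow>\<^sub>0 'k) set \<Rightarrow> 'k)" where
  "lin_smul V c f = (\<lambda>X\<in>qspace V. c * f X)"


section \<open>Tensor products and tensor algebras\<close>

definition space_pres ::
    "('k::field_char_0 \<Rightarrow> 'a::{ring, monoid_mult} \<Rightarrow> 'a) \<Rightarrow> ('a, 'k) presentation" where
  "space_pres scale = \<lparr> gens = UNIV,
     rels = {gen (a + b) - gen a - gen b | a b. True} \<union>
            {gen (scale c a) - smul c (gen a) | c a. True} \<rparr>"

definition tensor :: "('w, 'k::field_char_0) presentation \<Rightarrow> ('v, 'k) presentation \<Rightarrow>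
    ('w \<times> 'v, 'k) presentation" where
  "tensor V V' = \<lparr> gens = gens V \<times> gens V',
     rels = {lin_ext (\<lambda>x. gen (x, y)) r | r y. r \<in> rels V \<and> y \<in> gens V'} \<union>
            {lin_ext (\<lambda>y. gen (x, y)) r | r x. r \<in> rels V' \<and> x \<in> gens V} \<rparr>"

text \<open>\<open>tensor_alg V\<close> is the direct sum of all tensor powers of \<open>V\<close>, of exponent 0 included: the
  list \<open>[x\<^sub>1, \<dots>, x\<^sub>k]\<close> is the tensor of the \<open>x\<^sub>i\<close> and the relations are
  \<open>u \<otimes> r \<otimes> v\<close> with \<open>r\<close> a relation of \<open>V\<close>. In \<open>tensor_alg_pos\<close> the
  exponent is at least 1.\<close>

definition tensor_alg :: "('w, 'k::field_char_0) presentation \<Rightarrow> ('w list, 'k) presentation" where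
  "tensor_alg V = \<lparr> gens = lists (gens V),
     rels = {lin_ext (\<lambda>x. gen (u @ x # v)) r | u v r.
               u \<in> lists (gens V) \<and> v \<in> lists (gens V) \<and> r \<in> rels V} \<rparr>"

definition tensor_alg_pos :: "('w, 'k::field_char_0) presentation \<Rightarrow> ('w list, 'k) presentation" where
  "tensor_alg_pos V = \<lparr> gens = gens (tensor_alg V) - {[]}, rels = rels (tensor_alg V) \<rparr>"


section \<open>Half-convolutions on the dual of a tensor algebra\<close>

abbreviation mult_tensor ::
    "('x list \<times> 'x list \<Rightarrow>\<^sub>0 'k::field_char_0) \<Rightarrow> ('x list \<times> 'x list \<Rightarrow>\<^sub>0 'k) \<Rightarrow>
     ('x list \<times> 'x list \<Rightarrow>\<^sub>0 'k)" where
  "mult_tensor \<equiv> bilin_ext (\<lambda>(u, v) (u', v'). (u @ u', v @ v'))"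

primrec cop_bar :: "('x \<Rightarrow> ('x list \<times> 'x list \<Rightarrow>\<^sub>0 'k::field_char_0)) \<Rightarrow> 'x list \<Rightarrow>
    ('x list \<times> 'x list \<Rightarrow>\<^sub>0 'k)" where
  "cop_bar \<delta> [] = gen ([], [])"
| "cop_bar \<delta> (x # xs) = mult_tensor (\<delta> x) (cop_bar \<delta> xs)"

text \<open>\<open>\<delta>\<close> is the full coproduct and \<open>\<delta>h\<close> its left or right half, both on the letters of the
  bar words. The reduced halves are extended by zero to the empty bar word, so that the
  half-convolutions on the non-unital part become functionals vanishing at the unit.\<close>

primrec cop_half :: "('x \<Rightarrow> ('x list \<times> 'x list \<Rightarrow>\<^sub>0 'k::field_char_0)) \<Rightarrow>
    ('x \<Rightarrow> ('x list \<times> 'x list \<Rightarrow>\<^sub>0 'k)) \<Rightarrow> 'x list \<Rightarrow> ('x list \<times> 'x list \<Rightarrow>\<^sub>0 'k)" where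
  "cop_half \<delta>h \<delta> [] = 0"
| "cop_half \<delta>h \<delta> (x # xs) = mult_tensor (\<delta>h x) (cop_bar \<delta> xs)"

definition cop_prec :: "('x \<Rightarrow> ('x list \<times> 'x list \<Rightarrow>\<^sub>0 'k::field_char_0)) \<Rightarrow>
    ('x \<Rightarrow> ('x list \<times> 'x list \<Rightarrow>\<^sub>0 'k)) \<Rightarrow> 'x list \<Rightarrow> ('x list \<times> 'x list \<Rightarrow>\<^sub>0 'k)" where
  "cop_prec \<delta>h \<delta> w = (if w = [] then 0 else cop_half \<delta>h \<delta> w - gen (w, []))"

definition cop_succ :: "('x \<Rightarrow> ('x list \<times> 'x list \<Rightarrow>\<^sub>0 'k::field_char_0)) \<Rightarrow>
    ('x \<Rightarrow> ('x list \<times> 'x list \<Rightarrow>\<^sub>0 'k)) \<Rightarrow> 'x list \<Rightarrow> ('x list \<times> 'x list \<Rightarrow>\<^sub>0 'k)" where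
  "cop_succ \<delta>h \<delta> w = (if w = [] then 0 else cop_half \<delta>h \<delta> w - gen ([], w))"

text \<open>The functional \<open>m\<^sub>K \<circ> (f \<otimes> g)\<close> on a tensor product.\<close>

definition tensor_fun :: "('w, 'k::field_char_0) presentation \<Rightarrow> ('v, 'k) presentation \<Rightarrow>
    (('w \<Rightarrow>\<^sub>0 'k) set \<Rightarrow> 'k) \<Rightarrow> (('v \<Rightarrow>\<^sub>0 'k) set \<Rightarrow> 'k) \<Rightarrow> ('w \<times> 'v \<Rightarrow>\<^sub>0 'k) set \<Rightarrow> 'k" where
  "tensor_fun V V' f g Y =
     (let p = rep (tensor V V') Y in
      \<Sum>(x, y)\<in>Poly_Mapping.keys p.
        Poly_Mapping.lookup p (x, y) * (f (coset V (gen x)) * g (coset V' (gen y))))"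

text \<open>In the remainder of this section \<open>H\<close> is a presentation of the form \<open>tensor_alg V\<close>.\<close>

definition unit_fun :: "('x list, 'k::field_char_0) presentation \<Rightarrow> ('x list \<Rightarrow>\<^sub>0 'k) set \<Rightarrow> 'k" where
  "unit_fun H = (\<lambda>X\<in>qspace H. Poly_Mapping.lookup (rep H X) [])"

definition at_unit :: "('x list, 'k::field_char_0) presentation \<Rightarrow>
    (('x list \<Rightarrow>\<^sub>0 'k) set \<Rightarrow> 'k) \<Rightarrow> 'k" where
  "at_unit H f = f (coset H (gen []))"

text \<open>Every functional is uniquely \<open>f' + \<alpha> e\<close> with \<open>f'\<close> vanishing at the unit and
  \<open>\<alpha> = at_unit H f\<close>. The reduced halves of the coproduct take values in the tensor square of the
  non-unital part, so the first summand below depends only on the primed components, and the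
  second one implements the conventions \<open>f' \<prec> e = f'\<close>, \<open>e \<prec> f' = 0\<close> (respectively
  \<open>e \<succ> f' = f'\<close>, \<open>f' \<succ> e = 0\<close>) by bilinearity. The customarily undefined products
  \<open>e \<prec> e\<close> and \<open>e \<succ> e\<close> get the value 0.\<close>

definition half_prec :: "('x list, 'k::field_char_0) presentation \<Rightarrow>
    ('x list \<Rightarrow> ('x list \<times> 'x list \<Rightarrow>\<^sub>0 'k)) \<Rightarrow> (('x list \<Rightarrow>\<^sub>0 'k) set \<Rightarrow> 'k) \<Rightarrow>
    (('x list \<Rightarrow>\<^sub>0 'k) set \<Rightarrow> 'k) \<Rightarrow> (('x list \<Rightarrow>\<^sub>0 'k) set \<Rightarrow> 'k)" where
  "half_prec H D f g = (\<lambda>X\<in>qspace H.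
     tensor_fun H H f g (induced H (tensor H H) D X)
     + at_unit H g * (f X - at_unit H f * unit_fun H X))"

definition half_succ :: "('x list, 'k::field_char_0) presentation \<Rightarrow>
    ('x list \<Rightarrow> ('x list \<times> 'x list \<Rightarrow>\<^sub>0 'k)) \<Rightarrow> (('x list \<Rightarrow>\<^sub>0 'k) set \<Rightarrow> 'k) \<Rightarrow>
    (('x list \<Rightarrow>\<^sub>0 'k) set \<Rightarrow> 'k) \<Rightarrow> (('x list \<Rightarrow>\<^sub>0 'k) set \<Rightarrow> 'k)" where
  "half_succ H D f g = (\<lambda>X\<in>qspace H.
     tensor_fun H H f g (induced H (tensor H H) D X)
     + at_unit H f * (g X - at_unit H g * unit_fun H X))"


section \<open>Subwords and maximal sets of consecutive integers\<close>

text \<open>Positions in words are counted from 1.\<close>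

definition subword :: "'a list \<Rightarrow> nat set \<Rightarrow> 'a list" where
  "subword w S = nths w {i. Suc i \<in> S}"

definition runs :: "nat set \<Rightarrow> nat set set" where
  "runs X = {J. J \<noteq> {} \<and> (\<exists>a b. J = {a..b}) \<and> J \<subseteq> X \<and>
     (\<forall>a b. J \<subseteq> {a..b} \<and> {a..b} \<subseteq> X \<longrightarrow> {a..b} = J)}"

definition runs_list :: "nat set \<Rightarrow> nat set list" where
  "runs_list X = sorted_key_list_of_set Min (runs X)"


section \<open>The double tensor algebra\<close>

definition TA :: "('k::field_char_0 \<Rightarrow> 'a::{ring, monoid_mult} \<Rightarrow> 'a) \<Rightarrow>
    ('a list, 'k) presentation" where
  "TA scale = tensor_alg_pos (space_pres scale)"

definition TTA :: "('k::field_char_0 \<Rightarrow> 'a::{ring, monoid_mult} \<Rightarrow> 'a) \<Rightarrow>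
    ('a list list, 'k) presentation" where
  "TTA scale = tensor_alg (TA scale)"

definition cop_term :: "'a list \<Rightarrow> nat set \<Rightarrow> 'a list list \<times> 'a list list" where
  "cop_term w S =
     (if S = {} then [] else [subword w S],
      map (subword w) (runs_list ({1..length w} - S)))"

definition cop_A :: "'a list \<Rightarrow> ('a list list \<times> 'a list list \<Rightarrow>\<^sub>0 'k::field_char_0)" where
  "cop_A w = (\<Sum>S\<in>{S. S \<subseteq> {1..length w}}. gen (cop_term w S))"

definition cop_A_prec :: "'a list \<Rightarrow> ('a list list \<times> 'a list list \<Rightarrow>\<^sub>0 'k::field_char_0)" where
  "cop_A_prec w = (\<Sum>S\<in>{S. S \<subseteq> {1..length w} \<and> 1 \<in> S}. gen (cop_term w S))"

definition cop_A_succ :: "'a list \<Rightarrow> ('a list list \<times> 'a list list \<Rightarrow>\<^sub>0 'k::field_char_0)" where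
  "cop_A_succ w = (\<Sum>S\<in>{S. S \<subseteq> {1..length w} \<and> 1 \<notin> S}. gen (cop_term w S))"

definition prec_A :: "('k::field_char_0 \<Rightarrow> 'a::{ring, monoid_mult} \<Rightarrow> 'a) \<Rightarrow>
    (('a list list \<Rightarrow>\<^sub>0 'k) set \<Rightarrow> 'k) \<Rightarrow> (('a list list \<Rightarrow>\<^sub>0 'k) set \<Rightarrow> 'k) \<Rightarrow>
    (('a list list \<Rightarrow>\<^sub>0 'k) set \<Rightarrow> 'k)" where
  "prec_A scale = half_prec (TTA scale) (cop_prec cop_A_prec cop_A)"

definition succ_A :: "('k::field_char_0 \<Rightarrow> 'a::{ring, monoid_mult} \<Rightarrow> 'a) \<Rightarrow>
    (('a list list \<Rightarrow>\<^sub>0 'k) set \<Rightarrow> 'k) \<Rightarrow> (('a list list \<Rightarrow>\<^sub>0 'k) set \<Rightarrow> 'k) \<Rightarrow>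
    (('a list list \<Rightarrow>\<^sub>0 'k) set \<Rightarrow> 'k)" where
  "succ_A scale = half_succ (TTA scale) (cop_succ cop_A_succ cop_A)"


section \<open>Decorated non-crossing partitions\<close>

definition noncrossing :: "nat set set \<Rightarrow> bool" where
  "noncrossing L \<longleftrightarrow>
     \<not> (\<exists>B\<in>L. \<exists>C\<in>L. B \<noteq> C \<and>
          (\<exists>p1 q1 p2 q2. p1 < q1 \<and> q1 < p2 \<and> p2 < q2 \<and>
             p1 \<in> B \<and> p2 \<in> B \<and> q1 \<in> C \<and> q2 \<in> C))"

definition NC :: "nat \<Rightarrow> nat set set set" where
  "NC n = {L. partition_on {1..n} L \<and> noncrossing L}"

definition nested_in :: "nat set \<Rightarrow> nat set \<Rightarrow> bool" where
  "nested_in B C \<longleftrightarrow> (\<forall>m\<in>B. Min C < m \<and> m < Max C)"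

text \<open>\<open>Q\<close> determines the decomposition of \<open>L\<close>, with \<open>U = L - Q\<close>.\<close>

definition admissible :: "nat set set \<Rightarrow> nat set set \<Rightarrow> bool" where
  "admissible L Q \<longleftrightarrow> Q \<subseteq> L \<and> (\<forall>B\<in>Q. \<forall>C\<in>L - Q. \<not> nested_in B C)"

definition st :: "nat set set \<Rightarrow> nat set set" where
  "st P = (\<lambda>B. (\<lambda>x. card {y \<in> \<Union>P. y \<le> x}) ` B) ` P"

text \<open>The direct sum over \<open>n \<ge> 1\<close> of the tensor products of the vector space with basis
  \<open>NC n\<close> and the \<open>n\<close>-th tensor power of \<open>A\<close>. The relations of \<open>TA\<close> are homogeneous; those of degree
  \<open>n\<close> present the \<open>n\<close>-th tensor power.\<close>

definition NCA :: "('k::field_char_0 \<Rightarrow> 'a::{ring, monoid_mult} \<Rightarrow> 'a) \<Rightarrow>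
    (nat set set \<times> 'a list, 'k) presentation" where
  "NCA scale = \<lparr> gens = {(L, w). w \<in> gens (TA scale) \<and> L \<in> NC (length w)},
     rels = {lin_ext (\<lambda>w. gen (L, w)) r | L r n. 1 \<le> n \<and> L \<in> NC n \<and>
               r \<in> rels (TA scale) \<and> r \<in> free_on {w. length w = n}} \<rparr>"

definition TNCA :: "('k::field_char_0 \<Rightarrow> 'a::{ring, monoid_mult} \<Rightarrow> 'a) \<Rightarrow>
    ((nat set set \<times> 'a list) list, 'k) presentation" where
  "TNCA scale = tensor_alg (NCA scale)"

definition cop_NC_term :: "nat set set \<times> 'a list \<Rightarrow> nat set set \<Rightarrow>
    (nat set set \<times> 'a list) list \<times> (nat set set \<times> 'a list) list" where
  "cop_NC_term = (\<lambda>(L, w) Q.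
     (if Q = {} then [] else [(st Q, subword w (\<Union>Q))],
      map (\<lambda>J. (st {B \<in> L - Q. B \<subseteq> J}, subword w J)) (runs_list ({1..length w} - \<Union>Q))))"

definition cop_NC :: "nat set set \<times> 'a list \<Rightarrow>
    ((nat set set \<times> 'a list) list \<times> (nat set set \<times> 'a list) list \<Rightarrow>\<^sub>0 'k::field_char_0)" where
  "cop_NC x = (\<Sum>Q\<in>{Q. admissible (fst x) Q}. gen (cop_NC_term x Q))"

definition cop_NC_prec :: "nat set set \<times> 'a list \<Rightarrow>
    ((nat set set \<times> 'a list) list \<times> (nat set set \<times> 'a list) list \<Rightarrow>\<^sub>0 'k::field_char_0)" where
  "cop_NC_prec x =
     (\<Sum>Q\<in>{Q. admissible (fst x) Q \<and> (\<exists>B\<in>Q. 1 \<in> B)}. gen (cop_NC_term x Q))"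

definition cop_NC_succ :: "nat set set \<times> 'a list \<Rightarrow>
    ((nat set set \<times> 'a list) list \<times> (nat set set \<times> 'a list) list \<Rightarrow>\<^sub>0 'k::field_char_0)" where
  "cop_NC_succ x =
     (\<Sum>Q\<in>{Q. admissible (fst x) Q \<and> (\<exists>B\<in>fst x - Q. 1 \<in> B)}. gen (cop_NC_term x Q))"

definition prec_NC :: "('k::field_char_0 \<Rightarrow> 'a::{ring, monoid_mult} \<Rightarrow> 'a) \<Rightarrow>
    (((nat set set \<times> 'a list) list \<Rightarrow>\<^sub>0 'k) set \<Rightarrow> 'k) \<Rightarrow>
    (((nat set set \<times> 'a list) list \<Rightarrow>\<^sub>0 'k) set \<Rightarrow> 'k) \<Rightarrow>
    (((nat set set \<times> 'a list) list \<Rightarrow>\<^sub>0 'k) set \<Rightarrow> 'k)" where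
  "prec_NC scale = half_prec (TNCA scale) (cop_prec cop_NC_prec cop_NC)"

definition succ_NC :: "('k::field_char_0 \<Rightarrow> 'a::{ring, monoid_mult} \<Rightarrow> 'a) \<Rightarrow>
    (((nat set set \<times> 'a list) list \<Rightarrow>\<^sub>0 'k) set \<Rightarrow> 'k) \<Rightarrow>
    (((nat set set \<times> 'a list) list \<Rightarrow>\<^sub>0 'k) set \<Rightarrow> 'k) \<Rightarrow>
    (((nat set set \<times> 'a list) list \<Rightarrow>\<^sub>0 'k) set \<Rightarrow> 'k)" where
  "succ_NC scale = half_succ (TNCA scale) (cop_succ cop_NC_succ cop_NC)"


section \<open>The splitting map\<close>

definition Sp_word :: "'a list \<Rightarrow> ((nat set set \<times> 'a list) list \<Rightarrow>\<^sub>0 'k::field_char_0)" where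
  "Sp_word w = (\<Sum>L\<in>NC (length w). gen [(L, w)])"

primrec Sp_bar :: "'a list list \<Rightarrow> ((nat set set \<times> 'a list) list \<Rightarrow>\<^sub>0 'k::field_char_0)" where
  "Sp_bar [] = gen []"
| "Sp_bar (w # ws) = bilin_ext (@) (Sp_word w) (Sp_bar ws)"

definition Sp :: "('k::field_char_0 \<Rightarrow> 'a::{ring, monoid_mult} \<Rightarrow> 'a) \<Rightarrow>
    ('a list list \<Rightarrow>\<^sub>0 'k) set \<Rightarrow> ((nat set set \<times> 'a list) list \<Rightarrow>\<^sub>0 'k) set" where
  "Sp scale = induced (TTA scale) (TNCA scale) Sp_bar"

definition Sp_dual :: "('k::field_char_0 \<Rightarrow> 'a::{ring, monoid_mult} \<Rightarrow> 'a) \<Rightarrow>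
    (((nat set set \<times> 'a list) list \<Rightarrow>\<^sub>0 'k) set \<Rightarrow> 'k) \<Rightarrow> (('a list list \<Rightarrow>\<^sub>0 'k) set \<Rightarrow> 'k)" where
  "Sp_dual scale f = (\<lambda>X\<in>qspace (TTA scale). f (Sp scale X))"

end

theory Submission
  imports Defs
begin

text \<open>For a fixed set \<open>S\<close> of positions, the pairs \<open>(L, Q)\<close> with \<open>L\<close> non-crossing, \<open>Q\<close> admissible
  and \<open>\<Union>Q = S\<close> correspond to a non-crossing partition of \<open>S\<close> together with one non-crossing
  partition of every maximal interval of the complement: admissibility and the absence of crossings
  force each block outside \<open>Q\<close> into a single interval. Hence \<open>(Sp \<otimes> Sp) \<circ> \<Delta> = \<Delta> \<circ> Sp\<close> on words, and
  likewise for both halves, since \<open>1 \<in> S\<close> says that the block of \<open>1\<close> lies in \<open>Q\<close>;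
  multiplicativity extends this to bar words, and dualising gives the theorem.

  As the spaces are quotients, a functional is handled through its values on generators, and a map
  on generators descends to the quotient because it is linear in each decoration separately.\<close>

section \<open>Functionals on presented vector spaces\<close>

text \<open>Identities between elements of free spaces are stated by pairing both sides with an
  arbitrary function on generators. Linear and bilinear extensions then turn into nested finite
  sums, and Sp \<otimes> Sp never has to be built as a map between quotients: it appears only as a
  pullback of test functions. The obstacle is that \<open>induced\<close>, \<open>tensor_fun\<close>
  and \<open>unit_fun\<close> read off chosen representatives. The representative of
  \<open>Sp X\<close> has no visible relation to the image under \<open>Sp_bar\<close> of the
  representative of \<open>X\<close>, so before the combinatorics applies, the functional that sends
  a decorated bar word to the value of f \<otimes> g on its half-coproduct must be shown to vanish
  on all relations. This is the reason for the linearity arguments in the later parts. For the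
  coproducts they are carried out on decorated partitions alone, since on the side of words both
  functionals are computed from one and the same representative of \<open>X\<close>.\<close>

definition ev :: "('w \<Rightarrow> 'k::field_char_0) \<Rightarrow> ('w \<Rightarrow>\<^sub>0 'k) \<Rightarrow> 'k" where
  "ev \<phi> p = (\<Sum>w\<in>Poly_Mapping.keys p. Poly_Mapping.lookup p w * \<phi> w)"

lemma ev_superset:
  assumes "finite A" "Poly_Mapping.keys p \<subseteq> A"
  shows "ev \<phi> p = (\<Sum>w\<in>A. Poly_Mapping.lookup p w * \<phi> w)"
  unfolding ev_def using assms by (intro sum.mono_neutral_left) (auto simp: in_keys_iff)

lemma ev_zero [simp]: "ev \<phi> 0 = 0"
  by (simp add: ev_def)

lemma ev_single [simp]: "ev \<phi> (Poly_Mapping.single w c) = c * \<phi> w"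
  using ev_superset[of "{w}" "Poly_Mapping.single w c" \<phi>] by simp

lemma ev_add: "ev \<phi> (p + q) = ev \<phi> p + ev \<phi> q"
proof -
  let ?A = "Poly_Mapping.keys p \<union> Poly_Mapping.keys q"
  have "ev \<phi> r = (\<Sum>w\<in>?A. Poly_Mapping.lookup r w * \<phi> w)" if "r \<in> {p, q, p + q}" for r
    using that keys_add[of p q] by (intro ev_superset) auto
  then show ?thesis
    by (simp add: lookup_add distrib_right sum.distrib)
qed

lemma ev_smul: "ev \<phi> (smul c p) = c * ev \<phi> p"
proof -
  have "Poly_Mapping.keys (smul c p) \<subseteq> Poly_Mapping.keys p"
    by (auto simp: in_keys_iff lookup_smul)
  then have "ev \<phi> (smul c p) = (\<Sum>w\<in>Poly_Mapping.keys p. Poly_Mapping.lookup (smul c p) w * \<phi> w)"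
    by (intro ev_superset) auto
  then show ?thesis
    by (simp add: ev_def lookup_smul sum_distrib_left mult.assoc)
qed

lemma ev_diff: "ev \<phi> (p - q) = ev \<phi> p - ev \<phi> q"
  using ev_add[of \<phi> "p - q" q] by simp

lemma ev_sum: "ev \<phi> (sum p A) = (\<Sum>i\<in>A. ev \<phi> (p i))"
  by (induction A rule: infinite_finite_induct) (simp_all add: ev_add)

lemma ev_lin_ext: "ev \<phi> (lin_ext \<psi> p) = ev (\<lambda>w. ev \<phi> (\<psi> w)) p"
  unfolding lin_ext_def ev_sum ev_smul by (simp add: ev_def)

lemma ev_bilin_ext: "ev \<phi> (bilin_ext m p q) = ev (\<lambda>x. ev (\<lambda>y. \<phi> (m x y)) q) p"
  unfolding bilin_ext_def ev_sum ev_single by (simp add: ev_def sum_distrib_left mult_ac)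

lemma ev_cong:
  "(\<And>w. w \<in> Poly_Mapping.keys p \<Longrightarrow> \<phi> w = \<psi> w) \<Longrightarrow> ev \<phi> p = ev \<psi> p"
  by (simp add: ev_def)

lemma ev_fun_add: "ev (\<lambda>w. \<phi> w + \<psi> w) p = ev \<phi> p + ev \<psi> p"
  by (simp add: ev_def algebra_simps sum.distrib)

lemma ev_fun_mult: "ev (\<lambda>w. c * \<phi> w) p = c * ev \<phi> p"
  by (simp add: ev_def sum_distrib_left mult_ac)

lemma ev_fun_mult_right: "ev (\<lambda>w. \<phi> w * c) p = ev \<phi> p * c"
  using ev_fun_mult[of c \<phi> p] by (simp add: mult.commute)

lemma ev_fun_diff: "ev (\<lambda>w. \<phi> w - \<psi> w) p = ev \<phi> p - ev \<psi> p"
  using ev_fun_add[of "\<lambda>w. \<phi> w - \<psi> w" \<psi> p] by simp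

text \<open>Fubini for finite supports; the tensor legs and factors are reordered by this rule in
  the later parts.\<close>

lemma ev_swap: "ev (\<lambda>x. ev (\<lambda>y. \<phi> x y) q) p = ev (\<lambda>y. ev (\<lambda>x. \<phi> x y) p) q"
  unfolding ev_def sum_distrib_left
  by (subst sum.swap) (simp add: mult.left_commute)

lemma ev_fun_zero: "(\<And>w. w \<in> Poly_Mapping.keys p \<Longrightarrow> \<phi> w = 0) \<Longrightarrow> ev \<phi> p = 0"
  by (simp add: ev_def)

text \<open>Coefficients are pairings with indicator functions, so the rules for \<open>ev\<close>
  also determine supports.\<close>

lemma lookup_eq_ev: "Poly_Mapping.lookup p w = ev (\<lambda>x. if x = w then 1 else 0) p"
  by (cases "w \<in> Poly_Mapping.keys p")
     (auto simp: ev_def in_keys_iff if_distrib sum.delta cong: if_cong)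

lemma keys_lin_ext: "Poly_Mapping.keys (lin_ext \<phi> p) \<subseteq> (\<Union>w\<in>Poly_Mapping.keys p. Poly_Mapping.keys (\<phi> w))"
proof
  fix v assume v: "v \<in> Poly_Mapping.keys (lin_ext \<phi> p)"
  show "v \<in> (\<Union>w\<in>Poly_Mapping.keys p. Poly_Mapping.keys (\<phi> w))"
  proof (rule ccontr)
    assume "\<not> ?thesis"
    then have "Poly_Mapping.lookup (\<phi> w) v = 0" if "w \<in> Poly_Mapping.keys p" for w
      using that by (auto simp: in_keys_iff)
    then have "Poly_Mapping.lookup (lin_ext \<phi> p) v = 0"
      by (simp add: lookup_eq_ev ev_lin_ext ev_fun_zero)
    with v show False by (simp add: in_keys_iff)
  qed
qed

lemma keys_bilin_ext:
  "Poly_Mapping.keys (bilin_ext m p q) \<subseteq> (\<lambda>(x, y). m x y) ` (Poly_Mapping.keys p \<times> Poly_Mapping.keys q)"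
proof
  fix v assume v: "v \<in> Poly_Mapping.keys (bilin_ext m p q)"
  show "v \<in> (\<lambda>(x, y). m x y) ` (Poly_Mapping.keys p \<times> Poly_Mapping.keys q)"
  proof (rule ccontr)
    assume "\<not> ?thesis"
    then have "m x y \<noteq> v" if "x \<in> Poly_Mapping.keys p" "y \<in> Poly_Mapping.keys q" for x y
      using that by force
    then have "Poly_Mapping.lookup (bilin_ext m p q) v = 0"
      unfolding lookup_eq_ev ev_bilin_ext by (intro ev_fun_zero) auto
    with v show False by (simp add: in_keys_iff)
  qed
qed

text \<open>The condition for \<open>ev \<phi>\<close> to be constant on cosets, and hence to define
  a functional on the quotient.\<close>

definition compatible :: "('w, 'k::field_char_0) presentation \<Rightarrow> ('w \<Rightarrow> 'k) \<Rightarrow> bool" where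
  "compatible V \<phi> \<longleftrightarrow> (\<forall>r\<in>rels V. ev \<phi> r = 0)"

interpretation smul: vector_space "smul :: 'k::field_char_0 \<Rightarrow> ('w \<Rightarrow>\<^sub>0 'k) \<Rightarrow> _"
  by (rule vector_space_smul)

lemma compatible_span:
  assumes "compatible V \<phi>" "p \<in> smul.span (rels V)"
  shows "ev \<phi> p = 0"
  using assms(2)
proof (induction rule: smul.span_induct_alt)
  case base
  show ?case by simp
next
  case (step c x y)
  then show ?case using assms(1) by (simp add: ev_add ev_smul compatible_def)
qed

lemma coset_eq_iff: "coset V p = coset V q \<longleftrightarrow> p - q \<in> smul.span (rels V)"
proof
  assume "coset V p = coset V q"
  moreover have "p \<in> coset V p" by (simp add: coset_def smul.span_zero)
  ultimately show "p - q \<in> smul.span (rels V)" by (simp add: coset_def)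
next
  assume d: "p - q \<in> smul.span (rels V)"
  have "x - p \<in> smul.span (rels V) \<longleftrightarrow> x - q \<in> smul.span (rels V)" for x
    using smul.span_add[OF _ d, of "x - p"] smul.span_diff[OF _ d, of "x - q"] by auto
  then show "coset V p = coset V q" by (auto simp: coset_def)
qed

lemma rep_coset:
  assumes "p \<in> free_on (gens V)"
  shows "rep V (coset V p) \<in> free_on (gens V)" "coset V (rep V (coset V p)) = coset V p"
proof -
  have "rep V (coset V p) \<in> free_on (gens V) \<and> coset V (rep V (coset V p)) = coset V p"
    unfolding rep_def by (rule someI[of _ p]) (simp add: assms)
  then show "rep V (coset V p) \<in> free_on (gens V)" "coset V (rep V (coset V p)) = coset V p"
    by simp_all
qed

lemma rep_qspace:
  assumes "X \<in> qspace V"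
  shows "rep V X \<in> free_on (gens V)" "coset V (rep V X) = X"
proof -
  obtain p where "p \<in> free_on (gens V)" "X = coset V p"
    using assms by (auto simp: qspace_def)
  then show "rep V X \<in> free_on (gens V)" "coset V (rep V X) = X"
    by (simp_all add: rep_coset)
qed

lemma coset_in_qspace: "p \<in> free_on (gens V) \<Longrightarrow> coset V p \<in> qspace V"
  by (simp add: qspace_def)

lemma ev_coset_cong:
  assumes "compatible V \<phi>" "coset V p = coset V q"
  shows "ev \<phi> p = ev \<phi> q"
  using compatible_span[OF assms(1)] assms(2) unfolding coset_eq_iff
  by (metis ev_diff eq_iff_diff_eq_0)

text \<open>\<open>rep\<close> is an unspecified choice; this rule trades it for a representative
  that is known.\<close>

lemma ev_rep_coset:
  assumes "compatible V \<phi>" "p \<in> free_on (gens V)"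
  shows "ev \<phi> (rep V (coset V p)) = ev \<phi> p"
  using assms(1) rep_coset(2)[OF assms(2)] by (rule ev_coset_cong)

lemma free_on_zero [simp]: "0 \<in> free_on W"
  and free_on_gen [simp]: "gen w \<in> free_on W \<longleftrightarrow> w \<in> W"
  by (auto simp: free_on_def)

lemma free_on_add: "p \<in> free_on W \<Longrightarrow> q \<in> free_on W \<Longrightarrow> p + q \<in> free_on W"
  using keys_add[of p q] by (auto simp: free_on_def)

lemma free_on_smul: "p \<in> free_on W \<Longrightarrow> smul c p \<in> free_on W"
  by (auto simp: free_on_def in_keys_iff lookup_smul)

lemma free_on_diff: "p \<in> free_on W \<Longrightarrow> q \<in> free_on W \<Longrightarrow> p - q \<in> free_on W"
  using keys_diff[of p q] by (auto simp: free_on_def)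

lemma free_on_sum: "(\<And>i. i \<in> I \<Longrightarrow> p i \<in> free_on W) \<Longrightarrow> sum p I \<in> free_on W"
  by (induction I rule: infinite_finite_induct) (auto intro: free_on_add)

lemma free_on_lin_ext:
  assumes "p \<in> free_on W" "\<And>w. w \<in> W \<Longrightarrow> \<phi> w \<in> free_on W'"
  shows "lin_ext \<phi> p \<in> free_on W'"
  using assms(1) assms(2)[unfolded free_on_def] keys_lin_ext[of \<phi> p]
  unfolding free_on_def by blast

lemma free_on_bilin_ext:
  assumes "p \<in> free_on W" "q \<in> free_on W'" "\<And>x y. x \<in> W \<Longrightarrow> y \<in> W' \<Longrightarrow> m x y \<in> W''"
  shows "bilin_ext m p q \<in> free_on W''"
proof -
  have "(\<lambda>(x, y). m x y) ` (Poly_Mapping.keys p \<times> Poly_Mapping.keys q) \<subseteq> W''"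
    using assms by (auto simp: free_on_def)
  then show ?thesis using keys_bilin_ext[of m p q] by (auto simp: free_on_def)
qed

lemma poly_mapping_eq_lin_ext_gen: "lin_ext gen p = p"
  by (rule poly_mapping_eqI) (simp add: lookup_eq_ev ev_lin_ext)

lemma Lin_coset_sum:
  assumes "f \<in> Lin V" "finite I" "\<And>i. i \<in> I \<Longrightarrow> p i \<in> free_on (gens V)"
  shows "f (coset V (\<Sum>i\<in>I. smul (c i) (p i))) = (\<Sum>i\<in>I. c i * f (coset V (p i)))"
  using assms(2,3)
proof (induction I)
  case empty
  \<comment> \<open>\<open>Lin\<close> has no clause for zero, so the value at the zero class comes
    from homogeneity with scalar 0.\<close>
  have "f (coset V (smul 0 0)) = 0 * f (coset V 0)"
    using assms(1) unfolding Lin_def by (simp del: smul.scale_zero_left smul.scale_zero_right)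
  then show ?case by simp
next
  case (insert i I)
  have "(\<Sum>i\<in>I. smul (c i) (p i)) \<in> free_on (gens V)"
    using insert by (intro free_on_sum free_on_smul) auto
  moreover have "p i \<in> free_on (gens V)" using insert by auto
  ultimately show ?case
    using assms(1) insert by (simp add: Lin_def free_on_smul)
qed

text \<open>Reduces a functional on the quotient to its values on generators, the form in which
  functionals enter the combinatorial parts.\<close>

lemma Lin_coset_eq_ev:
  assumes "f \<in> Lin V" "p \<in> free_on (gens V)"
  shows "f (coset V p) = ev (\<lambda>x. f (coset V (gen x))) p"
proof -
  have "f (coset V p) = f (coset V (lin_ext gen p))" by (simp add: poly_mapping_eq_lin_ext_gen)
  also have "\<dots> = ev (\<lambda>x. f (coset V (gen x))) p"
    unfolding lin_ext_def ev_def
    using assms by (intro Lin_coset_sum) (auto simp: free_on_def)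
  finally show ?thesis .
qed

text \<open>A relation has the coset of zero, so \<open>f\<close> kills it. Linearity in
  \<open>Lin\<close> is demanded only on \<open>free_on (gens V)\<close>, which is why the relations
  have to lie there.\<close>

lemma Lin_compatible:
  assumes "f \<in> Lin V" "rels V \<subseteq> free_on (gens V)"
  shows "compatible V (\<lambda>x. f (coset V (gen x)))"
  unfolding compatible_def
proof
  fix r assume r: "r \<in> rels V"
  then have "coset V r = coset V 0" by (simp add: coset_eq_iff smul.span_base)
  then have "f (coset V r) = f (coset V 0)" by simp
  with r show "ev (\<lambda>x. f (coset V (gen x))) r = 0"
    using assms Lin_coset_eq_ev[OF assms(1), of r] Lin_coset_eq_ev[OF assms(1), of 0] by auto
qed

lemma ev_rep_in_Lin:
  assumes "compatible V \<phi>"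
  shows "(\<lambda>X\<in>qspace V. ev \<phi> (rep V X)) \<in> Lin V"
  using assms unfolding Lin_def
  by (simp add: coset_in_qspace free_on_add free_on_smul ev_rep_coset ev_add ev_smul)

section \<open>Functionals on tensor products and tensor algebras\<close>

lemma compatible_tensor:
  assumes "compatible V \<phi>" "compatible V' \<psi>"
  shows "compatible (tensor V V') (\<lambda>(x, y). \<phi> x * \<psi> y)"
proof -
  have "ev (\<lambda>x. \<phi> x * \<psi> y) r = 0" if "r \<in> rels V" for r y
    using assms(1) that ev_fun_mult[of "\<psi> y" \<phi> r] by (simp add: compatible_def mult.commute)
  moreover have "ev (\<lambda>y. \<phi> x * \<psi> y) r = 0" if "r \<in> rels V'" for r x
    using assms(2) that by (simp add: compatible_def ev_fun_mult)
  ultimately show ?thesis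
    by (auto simp: compatible_def tensor_def ev_lin_ext)
qed

text \<open>\<open>tensor_fun\<close> reads a chosen representative. As the product function kills
  the relations of the tensor product, it may be evaluated on the given \<open>q\<close> instead,
  later a linear combination of coproducts.\<close>

lemma tensor_fun_coset:
  assumes "compatible V (\<lambda>x. f (coset V (gen x)))" "compatible V' (\<lambda>x. g (coset V' (gen x)))"
    and "q \<in> free_on (gens V \<times> gens V')"
  shows "tensor_fun V V' f g (coset (tensor V V') q)
    = ev (\<lambda>(x, y). f (coset V (gen x)) * g (coset V' (gen y))) q"
proof -
  have "tensor_fun V V' f g (coset (tensor V V') q)
    = ev (\<lambda>(x, y). f (coset V (gen x)) * g (coset V' (gen y))) (rep (tensor V V') (coset (tensor V V') q))"
    unfolding tensor_fun_def ev_def Let_def by (intro sum.cong) auto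
  also have "\<dots> = ev (\<lambda>(x, y). f (coset V (gen x)) * g (coset V' (gen y))) q"
    using assms by (intro ev_rep_coset compatible_tensor) (auto simp: tensor_def)
  finally show ?thesis .
qed

text \<open>A relation of the tensor algebra carries a relation of \<open>V\<close> in one slot and
  generators elsewhere, so compatibility is a condition on each slot separately. Applied on two
  levels, it becomes linearity in each single decoration.\<close>

lemma compatible_tensor_alg:
  "compatible (tensor_alg V) \<phi> \<longleftrightarrow>
    (\<forall>u\<in>lists (gens V). \<forall>v\<in>lists (gens V). compatible V (\<lambda>x. \<phi> (u @ x # v)))"
  (is "?l \<longleftrightarrow> ?r")
proof
  assume c: ?l
  have "ev (\<lambda>x. \<phi> (u @ x # v)) r = 0"
    if "u \<in> lists (gens V)" "v \<in> lists (gens V)" "r \<in> rels V" for u v r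
  proof -
    have "lin_ext (\<lambda>x. gen (u @ x # v)) r \<in> rels (tensor_alg V)"
      unfolding tensor_alg_def presentation.simps using that by blast
    then have "ev \<phi> (lin_ext (\<lambda>x. gen (u @ x # v)) r) = 0"
      using c unfolding compatible_def by blast
    then show ?thesis by (simp add: ev_lin_ext)
  qed
  then show ?r by (simp add: compatible_def)
next
  assume ?r
  then have "ev \<phi> (lin_ext (\<lambda>x. gen (u @ x # v)) r) = 0"
    if "u \<in> lists (gens V)" "v \<in> lists (gens V)" "r \<in> rels V" for u v r
    using that unfolding ev_lin_ext ev_single mult_1 compatible_def by blast
  then show ?l unfolding compatible_def tensor_alg_def presentation.simps by blast
qed

section \<open>Runs and non-crossing partitions\<close>

text \<open>Among the finitely many intervals between \<open>{a..b}\<close> and \<open>X\<close>,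
  one of largest cardinality is maximal for inclusion, hence a run.\<close>

lemma interval_in_run:
  assumes "finite X" "a \<le> b" "{a..b} \<subseteq> X"
  shows "\<exists>J\<in>runs X. {a..b} \<subseteq> J"
proof -
  define I where "I = {K. (\<exists>c d. K = {c..d}) \<and> {a..b} \<subseteq> K \<and> K \<subseteq> X}"
  have fin: "finite I" using assms(1) by (auto simp: I_def intro: finite_subset[of _ "Pow X"])
  have "{a..b} \<in> I" using assms by (auto simp: I_def)
  with fin have "Max (card ` I) \<in> card ` I" by (intro Max_in) auto
  then obtain J where J: "J \<in> I" "card J = Max (card ` I)" by auto
  have "{c..d} = J" if "J \<subseteq> {c..d}" "{c..d} \<subseteq> X" for c d
  proof -
    have "{c..d} \<in> I" using that J(1) by (auto simp: I_def)
    then have "card {c..d} \<le> card J" unfolding J(2) using fin by (intro Max_ge finite_imageI imageI)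
    then show ?thesis using that(1) by (metis card_seteq finite_atLeastAtMost)
  qed
  moreover have sub: "{a..b} \<subseteq> J" and "J \<subseteq> X" "\<exists>c d. J = {c..d}"
    using J(1) by (auto simp: I_def)
  moreover have "J \<noteq> {}" using sub assms(2) by auto
  ultimately have "J \<in> runs X" by (simp add: runs_def)
  with sub show ?thesis by blast
qed

lemma run_maximal: "J \<in> runs X \<Longrightarrow> J \<subseteq> {a..b} \<Longrightarrow> {a..b} \<subseteq> X \<Longrightarrow> {a..b} = J"
  by (simp add: runs_def)

text \<open>Two intervals with a common point have an interval as their union, and by maximality it
  equals both.\<close>

lemma runs_eqI:
  assumes "J \<in> runs X" "K \<in> runs X" "x \<in> J" "x \<in> K"
  shows "J = K"
proof -
  obtain a b c d where JK: "J = {a..b}" "K = {c..d}"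
    using assms(1,2) unfolding runs_def by blast
  have u: "{min a c..max b d} = J \<union> K"
    using assms(3,4) by (auto simp: JK)
  have "J \<union> K \<subseteq> X" using assms(1,2) unfolding runs_def by blast
  then have "{min a c..max b d} = J" "{min a c..max b d} = K"
    using run_maximal[OF assms(1), of "min a c" "max b d"]
      run_maximal[OF assms(2), of "min a c" "max b d"] unfolding u by blast+
  then show ?thesis by simp
qed

lemma Union_runs: "finite X \<Longrightarrow> \<Union>(runs X) = X"
proof
  show "\<Union>(runs X) \<subseteq> X" by (auto simp: runs_def)
  show "X \<subseteq> \<Union>(runs X)" if "finite X"
  proof
    fix x assume "x \<in> X"
    then show "x \<in> \<Union>(runs X)" using interval_in_run[OF that, of x x] by auto
  qed
qed

lemma finite_runs: "finite X \<Longrightarrow> finite (runs X)"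
  by (rule finite_subset[of _ "Pow X"]) (auto simp: runs_def)

lemma runs_interval:
  "J \<in> runs X \<Longrightarrow> x \<in> J \<Longrightarrow> z \<in> J \<Longrightarrow> x \<le> y \<Longrightarrow> y \<le> z \<Longrightarrow> y \<in> J"
  by (auto simp: runs_def)

lemma run_nonempty: "J \<in> runs X \<Longrightarrow> J \<noteq> {}"
  and run_subset: "J \<in> runs X \<Longrightarrow> J \<subseteq> X"
  by (auto simp: runs_def)

lemma finite_run: "J \<in> runs X \<Longrightarrow> finite J"
  by (auto simp: runs_def)

text \<open>Justifies the sort key of \<open>runs_list\<close>: distinct runs have distinct minima,
  so every run is listed exactly once.\<close>

lemma inj_on_Min_runs: "inj_on Min (runs X)"
  by (rule inj_onI) (metis Min_in finite_run run_nonempty runs_eqI)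

lemma (in linorder) sorted_key_list_of_set_inj_on:
  assumes "inj_on f A"
  shows "finite A \<Longrightarrow> set (sorted_key_list_of_set f A) = A"
    and "distinct (sorted_key_list_of_set f A)"
proof -
  \<comment> \<open>The carrier of the locale is \<open>A\<close> itself, so that injectivity of the
    key on \<open>A\<close> suffices.\<close>
  interpret fk: folding_insort_key "(\<le>)" "(<)" A f
    by unfold_locales (rule assms)
  show "finite A \<Longrightarrow> set (sorted_key_list_of_set f A) = A"
    by simp
  show "distinct (sorted_key_list_of_set f A)"
    using fk.distinct_sorted_key_list_of_set[of A] by (simp add: distinct_map)
qed

lemma set_runs_list [simp]: "finite X \<Longrightarrow> set (runs_list X) = runs X"
  and distinct_runs_list: "distinct (runs_list X)"
  by (simp_all add: runs_list_def sorted_key_list_of_set_inj_on inj_on_Min_runs finite_runs)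

lemma length_subword: "length (subword w S) = card (S \<inter> {1..length w})"
proof -
  \<comment> \<open>\<open>nths\<close> counts positions from 0, \<open>S\<close> from 1;
    \<open>Suc\<close> translates between the two.\<close>
  have "S \<inter> {1..length w} = Suc ` {i. i < length w \<and> Suc i \<in> S}"
  proof
    show "S \<inter> {1..length w} \<subseteq> Suc ` {i. i < length w \<and> Suc i \<in> S}"
    proof
      fix x assume "x \<in> S \<inter> {1..length w}"
      then show "x \<in> Suc ` {i. i < length w \<and> Suc i \<in> S}" by (cases x) auto
    qed
  qed auto
  then show ?thesis by (simp add: subword_def length_nths card_image)
qed

section \<open>Non-crossing partitions of finite sets and their standardisation\<close>

lemma partition_on_subfamily:
  "partition_on A P \<Longrightarrow> Q \<subseteq> P \<Longrightarrow> \<Union>Q = B \<Longrightarrow> partition_on B Q"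
  unfolding partition_on_def by (auto intro: pairwise_subset)

text \<open>The chosen blocks and their restrictions to runs live on subsets of
  \<open>{1..n}\<close> until \<open>st\<close> renumbers them, so an arbitrary ground set is
  needed.\<close>

definition ncp :: "nat set \<Rightarrow> nat set set set" where
  "ncp S = {P. partition_on S P \<and> noncrossing P}"

lemma NC_eq_ncp: "NC n = ncp {1..n}"
  by (simp add: NC_def ncp_def)

lemma Union_ncp: "P \<in> ncp S \<Longrightarrow> \<Union>P = S"
  by (auto simp: ncp_def dest: partition_onD1)

lemma ncp_block_nonempty: "P \<in> ncp S \<Longrightarrow> B \<in> P \<Longrightarrow> B \<noteq> {}"
  by (auto simp: ncp_def dest: partition_onD3)

lemma finite_ncp: "finite S \<Longrightarrow> finite (ncp S)"
  unfolding ncp_def by (rule finite_subset[OF _ finitely_many_partition_on[of S]]) auto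

lemma noncrossingD:
  assumes "noncrossing L" "B \<in> L" "C \<in> L" "B \<noteq> C"
    and "p1 \<in> B" "q1 \<in> C" "p2 \<in> B" "q2 \<in> C"
  shows "\<not> (p1 < q1 \<and> q1 < p2 \<and> p2 < q2)"
  using assms unfolding noncrossing_def by metis

lemma noncrossingI:
  assumes "\<And>B C p1 q1 p2 q2. B \<in> L \<Longrightarrow> C \<in> L \<Longrightarrow> B \<noteq> C \<Longrightarrow> p1 \<in> B \<Longrightarrow> q1 \<in> C \<Longrightarrow> p2 \<in> B \<Longrightarrow> q2 \<in> C
    \<Longrightarrow> p1 < q1 \<Longrightarrow> q1 < p2 \<Longrightarrow> p2 < q2 \<Longrightarrow> False"
  shows "noncrossing L"
  unfolding noncrossing_def using assms by metis

text \<open>A crossing is a pattern of strict inequalities between four points, so it pulls back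
  along a strictly increasing map.\<close>

lemma ncp_image:
  assumes r: "strict_mono_on S r" and P: "P \<in> ncp S"
  shows "(`) r ` P \<in> ncp (r ` S)"
proof -
  have inj: "inj_on r S" using r by (rule strict_mono_on_imp_inj_on)
  have p: "partition_on S P" and nc: "noncrossing P" using P by (auto simp: ncp_def)
  have "(`) r ` P - {{}} = (`) r ` P" using partition_onD3[OF p] by auto
  then have "partition_on (r ` S) ((`) r ` P)"
    using partition_on_inj_image[OF p inj] by simp
  moreover have "noncrossing ((`) r ` P)"
  proof (rule noncrossingI)
    fix B' C' p1' q1' p2' q2'
    assume BC': "B' \<in> (`) r ` P" "C' \<in> (`) r ` P" "B' \<noteq> C'"
      and i': "p1' \<in> B'" "q1' \<in> C'" "p2' \<in> B'" "q2' \<in> C'"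
      and less: "p1' < q1'" "q1' < p2'" "p2' < q2'"
    obtain B C where BC: "B \<in> P" "C \<in> P" "B' = r ` B" "C' = r ` C" using BC' by auto
    obtain p1 q1 p2 q2 where i: "p1 \<in> B" "q1 \<in> C" "p2 \<in> B" "q2 \<in> C"
      and r': "p1' = r p1" "q1' = r q1" "p2' = r p2" "q2' = r q2"
      using i' unfolding BC(3,4) by (elim imageE) simp
    have "B \<subseteq> S" "C \<subseteq> S" using partition_onD1[OF p] BC by auto
    then have "p1 \<in> S" "q1 \<in> S" "p2 \<in> S" "q2 \<in> S" using i by auto
    then have "p1 < q1" "q1 < p2" "p2 < q2"
      using less unfolding r' by (simp_all add: strict_mono_on_less[OF r])
    moreover have "B \<noteq> C" using BC' BC by auto
    ultimately show False using noncrossingD[OF nc BC(1,2) _ i] by simp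
  qed
  ultimately show ?thesis by (simp add: ncp_def)
qed

text \<open>The inverse of a strictly increasing map is strictly increasing on the image, so
  \<open>ncp_image\<close> applies in both directions.\<close>

lemma bij_betw_ncp_image:
  assumes r: "strict_mono_on S r"
  shows "bij_betw ((`) ((`) r)) (ncp S) (ncp (r ` S))"
proof -
  have inj: "inj_on r S" using r by (rule strict_mono_on_imp_inj_on)
  define q where "q = inv_into S r"
  have q: "strict_mono_on (r ` S) q"
    unfolding q_def using inj by (auto intro!: strict_mono_onI simp: strict_mono_on_less[OF r])
  have qr: "q ` r ` B = B" if "B \<subseteq> S" for B
    using inj that by (simp add: q_def inv_into_image_cancel)
  have rq: "r ` q ` B = B" if "B \<subseteq> r ` S" for B
    using that by (simp add: q_def image_inv_into_cancel)
  have qS: "q ` r ` S = S" by (rule qr) simp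
  show ?thesis
  proof (rule bij_betw_byWitness[where f' = "(`) ((`) q)"])
    show "\<forall>P\<in>ncp S. (`) q ` (`) r ` P = P"
    proof
      fix P assume "P \<in> ncp S"
      then have "B \<subseteq> S" if "B \<in> P" for B using Union_ncp that by blast
      then show "(`) q ` (`) r ` P = P" using qr by (simp add: image_image)
    qed
    show "\<forall>P\<in>ncp (r ` S). (`) r ` (`) q ` P = P"
    proof
      fix P assume "P \<in> ncp (r ` S)"
      then have "B \<subseteq> r ` S" if "B \<in> P" for B using Union_ncp that by blast
      then show "(`) r ` (`) q ` P = P" using rq by (simp add: image_image)
    qed
    show "(`) ((`) r) ` ncp S \<subseteq> ncp (r ` S)" using ncp_image[OF r] by auto
    show "(`) ((`) q) ` ncp (r ` S) \<subseteq> ncp S" using ncp_image[OF q] qS by auto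
  qed
qed

text \<open>The rank function is the formula inside \<open>st\<close>. Being strictly increasing
  with image \<open>{1..card S}\<close>, by \<open>rank_image\<close>, it is the increasing
  bijection of the informal definition.\<close>

lemma strict_mono_on_rank:
  fixes S :: "nat set"
  assumes "finite S"
  shows "strict_mono_on S (\<lambda>x. card {y \<in> S. y \<le> x})"
proof (rule strict_mono_onI)
  fix x y assume "x \<in> S" "y \<in> S" "x < y"
  then have "{z \<in> S. z \<le> x} \<subset> {z \<in> S. z \<le> y}" by force
  then show "card {z \<in> S. z \<le> x} < card {z \<in> S. z \<le> y}"
    using assms by (intro psubset_card_mono) auto
qed

lemma rank_image:
  fixes S :: "nat set"
  assumes "finite S"
  shows "(\<lambda>x. card {y \<in> S. y \<le> x}) ` S = {1..card S}"
proof (rule card_subset_eq)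
  show "(\<lambda>x. card {y \<in> S. y \<le> x}) ` S \<subseteq> {1..card S}"
  proof safe
    fix x assume "x \<in> S"
    then have "card {y \<in> S. y \<le> x} \<noteq> 0" using assms by auto
    moreover have "card {y \<in> S. y \<le> x} \<le> card S" using assms by (intro card_mono) auto
    ultimately show "card {y \<in> S. y \<le> x} \<in> {1..card S}"
      unfolding atLeastAtMost_iff by linarith
  qed
  show "card ((\<lambda>x. card {y \<in> S. y \<le> x}) ` S) = card {1..card S}"
    using card_image[OF strict_mono_on_imp_inj_on[OF strict_mono_on_rank[OF assms]]] by simp
qed simp

text \<open>\<open>st\<close> ranks with respect to the union of the blocks. For members of
  \<open>ncp S\<close> this union is always \<open>S\<close>, so \<open>st\<close> is transport
  along one fixed increasing map.\<close>

lemma bij_betw_st: "finite S \<Longrightarrow> bij_betw st (ncp S) (NC (card S))"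
proof -
  assume fin: "finite S"
  have "bij_betw ((`) ((`) (\<lambda>x. card {y \<in> S. y \<le> x}))) (ncp S) (NC (card S))"
    using bij_betw_ncp_image[OF strict_mono_on_rank[OF fin]] by (simp add: rank_image[OF fin] NC_eq_ncp)
  then show ?thesis
    by (rule bij_betw_cong[THEN iffD1, rotated]) (simp add: st_def Union_ncp)
qed

text \<open>Non-crossing partitions of each member of a family of disjoint sets, encoded by the set of
  all their blocks.\<close>

definition ncu :: "nat set set \<Rightarrow> nat set set set" where
  "ncu \<J> = {R. partition_on (\<Union>\<J>) R \<and> (\<forall>B\<in>R. \<exists>J\<in>\<J>. B \<subseteq> J) \<and>
     (\<forall>J\<in>\<J>. noncrossing {B \<in> R. B \<subseteq> J})}"

lemma noncrossing_subset: "noncrossing L \<Longrightarrow> L' \<subseteq> L \<Longrightarrow> noncrossing L'"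
  by (rule noncrossingI) (meson noncrossingD subsetD)

text \<open>A block meeting \<open>J\<close> lies in some member of the family, which can only be
  \<open>J\<close> by disjointness; hence the blocks inside \<open>J\<close> cover it.\<close>

lemma ncu_restrict:
  assumes R: "R \<in> ncu \<J>" and J: "J \<in> \<J>" and d: "disjoint \<J>"
  shows "{B \<in> R. B \<subseteq> J} \<in> ncp J"
proof -
  have p: "partition_on (\<Union>\<J>) R" and sub: "\<And>B. B \<in> R \<Longrightarrow> \<exists>J\<in>\<J>. B \<subseteq> J"
    using R by (auto simp: ncu_def)
  have "J \<subseteq> \<Union>{B \<in> R. B \<subseteq> J}"
  proof
    fix x assume x: "x \<in> J"
    then obtain B where B: "B \<in> R" "x \<in> B" using partition_onD1[OF p] J by blast
    with sub obtain K where K: "K \<in> \<J>" "B \<subseteq> K" by blast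
    then have "K = J" using B x J d unfolding disjoint_def by blast
    then show "x \<in> \<Union>{B \<in> R. B \<subseteq> J}" using B K by auto
  qed
  then have "partition_on J {B \<in> R. B \<subseteq> J}"
    by (intro partition_on_subfamily[OF p] antisym) auto
  then show ?thesis using R J by (auto simp: ncp_def ncu_def)
qed

lemma finite_ncu: "finite (\<Union>\<J>) \<Longrightarrow> finite (ncu \<J>)"
  unfolding ncu_def by (rule finite_subset[OF _ finitely_many_partition_on[of "\<Union>\<J>"]]) auto

lemma ncu_empty: "ncu {} = {{}}"
  by (auto simp: ncu_def partition_on_empty)

text \<open>Peels one set off the family, for the induction in \<open>ev_Sp_bar_subwords\<close>.
  Blocks are nonempty and each lies in a single member, so inclusion in \<open>J\<close> separates
  the two parts of a union; the last two facts recover the parts.\<close>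

lemma ncu_insert:
  assumes d: "disjoint (insert J \<J>)" and J: "J \<notin> \<J>"
  shows "bij_betw (\<lambda>(P, R). P \<union> R) (ncp J \<times> ncu \<J>) (ncu (insert J \<J>))"
    and "\<And>P R. P \<in> ncp J \<Longrightarrow> R \<in> ncu \<J> \<Longrightarrow> {B \<in> P \<union> R. B \<subseteq> J} = P"
    and "\<And>P R K. P \<in> ncp J \<Longrightarrow> R \<in> ncu \<J> \<Longrightarrow> K \<in> \<J> \<Longrightarrow> {B \<in> P \<union> R. B \<subseteq> K} = {B \<in> R. B \<subseteq> K}"
proof -
  have dj: "J \<inter> K = {}" if "K \<in> \<J>" for K
    using d J that unfolding disjoint_def by (metis insertCI)
  have P: "B \<subseteq> J" "B \<noteq> {}" if "P \<in> ncp J" "B \<in> P" for P B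
    using that Union_ncp ncp_block_nonempty by blast+
  have R: "B \<noteq> {}" "\<exists>K\<in>\<J>. B \<subseteq> K" if "R \<in> ncu \<J>" "B \<in> R" for R B
    using that by (auto simp: ncu_def partition_on_def)
  have R': "\<not> B \<subseteq> J" if "R \<in> ncu \<J>" "B \<in> R" for R B
    using R[OF that] dj by blast
  show i: "{B \<in> P \<union> R. B \<subseteq> J} = P" if "P \<in> ncp J" "R \<in> ncu \<J>" for P R
    using P R' that by blast
  show ii: "{B \<in> P \<union> R. B \<subseteq> K} = {B \<in> R. B \<subseteq> K}" if "P \<in> ncp J" "R \<in> ncu \<J>" "K \<in> \<J>" for P R K
    using P[OF that(1)] dj[OF that(3)] by blast
  have un: "P \<union> R \<in> ncu (insert J \<J>)" if PR: "P \<in> ncp J" "R \<in> ncu \<J>" for P R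
  proof -
    have "partition_on (J \<union> \<Union>\<J>) (P \<union> R)"
    proof (rule partition_onI)
      show "\<Union>(P \<union> R) = J \<union> \<Union>\<J>"
        using Union_ncp[OF PR(1)] PR(2) unfolding ncu_def by (simp add: partition_on_def)
      show "{} \<notin> P \<union> R"
        using P(2)[OF PR(1)] R(1)[OF PR(2)] by auto
      show "disjnt p q" if "p \<in> P \<union> R" "q \<in> P \<union> R" "p \<noteq> q" for p q
      proof -
        have "disjoint P" "disjoint R" using PR by (auto simp: ncp_def ncu_def dest: partition_onD2)
        then have "disjnt p q" if "p \<in> P \<and> q \<in> P \<or> p \<in> R \<and> q \<in> R"
          using that \<open>p \<noteq> q\<close> by (auto simp: disjnt_def dest: disjointD)
        moreover have "disjnt B C" if BC: "B \<in> P" "C \<in> R" for B C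
        proof -
          obtain K where "K \<in> \<J>" "C \<subseteq> K" using R[OF PR(2) BC(2)] by blast
          then show ?thesis using P(1)[OF PR(1) BC(1)] dj[of K] by (auto simp: disjnt_iff)
        qed
        ultimately show ?thesis using that by (metis Un_iff disjnt_sym)
      qed
    qed
    moreover have "\<forall>B\<in>P \<union> R. \<exists>K\<in>insert J \<J>. B \<subseteq> K"
      using P(1)[OF PR(1)] R(2)[OF PR(2)] by auto
    moreover have "noncrossing {B \<in> P \<union> R. B \<subseteq> K}" if "K \<in> insert J \<J>" for K
    proof (cases "K = J")
      case True
      then show ?thesis using i[OF PR] PR by (simp add: ncp_def)
    next
      case False
      then have K: "K \<in> \<J>" using that by simp
      then show ?thesis using ii[OF PR K] PR by (simp add: ncu_def)
    qed
    ultimately show ?thesis by (simp add: ncu_def)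
  qed
  have dn: "{B \<in> R. \<not> B \<subseteq> J} \<in> ncu \<J>" if RR: "R \<in> ncu (insert J \<J>)" for R
  proof -
    have p: "partition_on (J \<union> \<Union>\<J>) R" and sub: "\<And>B. B \<in> R \<Longrightarrow> \<exists>K\<in>insert J \<J>. B \<subseteq> K"
      and nc: "\<And>K. K \<in> \<J> \<Longrightarrow> noncrossing {B \<in> R. B \<subseteq> K}"
      using RR by (auto simp: ncu_def)
    have sub': "\<exists>K\<in>\<J>. B \<subseteq> K" if "B \<in> R" "\<not> B \<subseteq> J" for B
      using sub that by blast
    have "\<Union>\<J> \<subseteq> \<Union>{B \<in> R. \<not> B \<subseteq> J}"
    proof
      fix x assume x: "x \<in> \<Union>\<J>"
      then obtain B where "B \<in> R" "x \<in> B" using partition_onD1[OF p] by blast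
      moreover have "x \<notin> J" using x dj by blast
      ultimately show "x \<in> \<Union>{B \<in> R. \<not> B \<subseteq> J}" by blast
    qed
    moreover have "\<Union>{B \<in> R. \<not> B \<subseteq> J} \<subseteq> \<Union>\<J>"
      using sub' by blast
    ultimately have "partition_on (\<Union>\<J>) {B \<in> R. \<not> B \<subseteq> J}"
      by (intro partition_on_subfamily[OF p] antisym) auto
    moreover have "noncrossing {B \<in> {B \<in> R. \<not> B \<subseteq> J}. B \<subseteq> K}" if "K \<in> \<J>" for K
      by (rule noncrossing_subset[OF nc[OF that]]) auto
    ultimately show ?thesis using sub' by (auto simp: ncu_def)
  qed
  show "bij_betw (\<lambda>(P, R). P \<union> R) (ncp J \<times> ncu \<J>) (ncu (insert J \<J>))"
  proof (rule bij_betw_byWitness[where f' = "\<lambda>R. ({B \<in> R. B \<subseteq> J}, {B \<in> R. \<not> B \<subseteq> J})"])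
    show "\<forall>a\<in>ncp J \<times> ncu \<J>. ({B \<in> case a of (P, R) \<Rightarrow> P \<union> R. B \<subseteq> J},
        {B \<in> case a of (P, R) \<Rightarrow> P \<union> R. \<not> B \<subseteq> J}) = a"
    proof
      fix a assume "a \<in> ncp J \<times> ncu \<J>"
      then obtain P R where a: "a = (P, R)" and PR: "P \<in> ncp J" "R \<in> ncu \<J>" by auto
      have "{B \<in> P \<union> R. \<not> B \<subseteq> J} = R" using P[OF PR(1)] R'[OF PR(2)] by blast
      then show "({B \<in> case a of (P, R) \<Rightarrow> P \<union> R. B \<subseteq> J},
        {B \<in> case a of (P, R) \<Rightarrow> P \<union> R. \<not> B \<subseteq> J}) = a"
        using i[OF PR] by (simp add: a)
    qed
    show "\<forall>R\<in>ncu (insert J \<J>). (case ({B \<in> R. B \<subseteq> J}, {B \<in> R. \<not> B \<subseteq> J}) of (P, R) \<Rightarrow> P \<union> R) = R"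
      by auto
    show "(\<lambda>(P, R). P \<union> R) ` (ncp J \<times> ncu \<J>) \<subseteq> ncu (insert J \<J>)"
      using un by auto
    show "(\<lambda>R. ({B \<in> R. B \<subseteq> J}, {B \<in> R. \<not> B \<subseteq> J})) ` ncu (insert J \<J>) \<subseteq> ncp J \<times> ncu \<J>"
      using dn ncu_restrict[OF _ _ d] by auto
  qed
qed

section \<open>Admissible decompositions\<close>

lemma disjoint_runs: "disjoint (runs X)"
  by (rule disjointI) (use runs_eqI in blast)

lemma ncp_same_block: "L \<in> ncp S \<Longrightarrow> B \<in> L \<Longrightarrow> C \<in> L \<Longrightarrow> x \<in> B \<Longrightarrow> x \<in> C \<Longrightarrow> B = C"
  using disjointD[of L B C] by (auto simp: ncp_def partition_on_def)

text \<open>Suppose a block \<open>B\<close> of \<open>Q\<close> has a point \<open>m\<close>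
  strictly between \<open>Min C\<close> and \<open>Max C\<close>. Admissibility says that
  \<open>B\<close> is not nested in \<open>C\<close>, so \<open>B\<close> also has a point beyond
  one end of \<open>C\<close>. That point, \<open>m\<close> and the two ends of \<open>C\<close>
  form a crossing. Hence the whole interval spanned by \<open>C\<close> avoids \<Union>Q and sits in
  one run.\<close>

lemma admissible_block_in_run:
  assumes L: "L \<in> NC n" and adm: "admissible L Q" and C: "C \<in> L - Q"
  shows "\<exists>J\<in>runs ({1..n} - \<Union>Q). C \<subseteq> J"
proof -
  have L': "L \<in> ncp {1..n}" using L by (simp add: NC_eq_ncp)
  then have nc: "noncrossing L" by (simp add: ncp_def)
  have QL: "Q \<subseteq> L" using adm by (simp add: admissible_def)
  have sub: "C \<subseteq> {1..n}" using Union_ncp[OF L'] C by blast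
  have fin: "finite C" using sub by (rule finite_subset) simp
  have ne: "C \<noteq> {}" using ncp_block_nonempty[OF L'] C by blast
  have mm: "Min C \<in> C" "Max C \<in> C" using fin ne by auto
  have "{Min C..Max C} \<subseteq> {1..n} - \<Union>Q"
  proof
    fix m assume m: "m \<in> {Min C..Max C}"
    have "m \<notin> B" if B: "B \<in> Q" for B
    proof
      assume mB: "m \<in> B"
      have BC: "B \<in> L" "C \<in> L" "B \<noteq> C" using B QL C by auto
      have d: "x \<notin> C" if "x \<in> B" for x using ncp_same_block[OF L' BC(1,2) that] BC(3) by blast
      have "m \<noteq> Min C" "m \<noteq> Max C" using d[OF mB] mm by auto
      then have lt: "Min C < m" "m < Max C" using m by auto
      obtain x where x: "x \<in> B" "\<not> (Min C < x \<and> x < Max C)"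
        using adm B C unfolding admissible_def nested_in_def by blast
      have "x \<noteq> Min C" "x \<noteq> Max C" using d[OF x(1)] mm by auto
      then consider "x < Min C" | "Max C < x" using x(2) by linarith
      then show False
      proof cases
        case 1
        then show False using noncrossingD[OF nc BC x(1) mm(1) mB mm(2)] lt by simp
      next
        case 2
        then show False
          using noncrossingD[OF nc BC(2,1) BC(3)[symmetric] mm(1) mB mm(2) x(1)] lt by simp
      qed
    qed
    moreover have "m \<in> {1..n}" using m mm sub by auto
    ultimately show "m \<in> {1..n} - \<Union>Q" by blast
  qed
  moreover have "Min C \<le> Max C" using fin ne by simp
  ultimately obtain J where "J \<in> runs ({1..n} - \<Union>Q)" "{Min C..Max C} \<subseteq> J"
    using interval_in_run[of "{1..n} - \<Union>Q" "Min C" "Max C"] by auto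
  moreover have "C \<subseteq> {Min C..Max C}" using fin by auto
  ultimately show ?thesis by blast
qed

lemma admissible_split:
  assumes L: "L \<in> NC n" and adm: "admissible L Q"
  shows "\<Union>Q \<subseteq> {1..n}" "Q \<in> ncp (\<Union>Q)" "L - Q \<in> ncu (runs ({1..n} - \<Union>Q))"
proof -
  have p: "partition_on {1..n} L" and nc: "noncrossing L" using L by (auto simp: NC_def)
  have QL: "Q \<subseteq> L" using adm by (simp add: admissible_def)
  show "\<Union>Q \<subseteq> {1..n}" using partition_onD1[OF p] QL by blast
  have "partition_on (\<Union>Q) Q" by (rule partition_on_subfamily[OF p QL refl])
  then show "Q \<in> ncp (\<Union>Q)" using noncrossing_subset[OF nc QL] by (simp add: ncp_def)
  have "\<Union>(L - Q) = {1..n} - \<Union>Q"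
  proof -
    have "x \<notin> B" if "x \<in> C" "C \<in> L - Q" "B \<in> Q" for x B C
      using ncp_same_block[of L "{1..n}" B C x] L QL that by (auto simp: NC_eq_ncp)
    then show ?thesis unfolding partition_onD1[OF p] by blast
  qed
  then have "partition_on (\<Union>(runs ({1..n} - \<Union>Q))) (L - Q)"
    by (intro partition_on_subfamily[OF p]) (auto simp: Union_runs)
  moreover have "noncrossing {B \<in> L - Q. B \<subseteq> J}" for J
    by (rule noncrossing_subset[OF nc]) auto
  ultimately show "L - Q \<in> ncu (runs ({1..n} - \<Union>Q))"
    using admissible_block_in_run[OF assms] by (simp add: ncu_def)
qed

text \<open>The converse of \<open>admissible_split\<close>. Runs are intervals disjoint from
  \<open>S\<close>: whatever lies between two points of a block of \<open>R\<close> is in its run,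
  hence outside \<open>S\<close>. This excludes crossings between \<open>Q\<close> and
  \<open>R\<close> as well as a block of \<open>Q\<close> nested in a block of
  \<open>R\<close>.\<close>

lemma admissible_join:
  assumes S: "S \<subseteq> {1..n}" and Q: "Q \<in> ncp S" and R: "R \<in> ncu (runs ({1..n} - S))"
  shows "Q \<union> R \<in> NC n" "admissible (Q \<union> R) Q" "Q \<union> R - Q = R"
proof -
  let ?X = "{1..n} - S"
  have pR: "partition_on ?X R" using R by (simp add: ncu_def Union_runs)
  have pQ: "partition_on S Q" using Q by (simp add: ncp_def)
  have QS: "B \<subseteq> S" "B \<noteq> {}" if "B \<in> Q" for B
    using pQ that unfolding partition_on_def by blast+
  have RX: "B \<subseteq> ?X" "B \<noteq> {}" if "B \<in> R" for B
    using pR that unfolding partition_on_def by blast+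
  have run: "\<exists>J\<in>runs ?X. B \<subseteq> J" if "B \<in> R" for B
    using R that by (simp add: ncu_def)
  have same: "C \<subseteq> J" if "C \<in> R" "J \<in> runs ?X" "x \<in> C" "x \<in> J" for C J x
    using run[OF that(1)] that runs_eqI by blast
  have QR: "Q \<inter> R = {}" using QS RX by blast
  then show "Q \<union> R - Q = R" by blast
  have "partition_on (S \<union> ?X) (Q \<union> R)"
  proof (rule partition_onI)
    show "\<Union>(Q \<union> R) = S \<union> ?X" using pQ pR by (simp add: partition_on_def)
    show "{} \<notin> Q \<union> R" using QS RX by blast
    show "disjnt p q" if "p \<in> Q \<union> R" "q \<in> Q \<union> R" "p \<noteq> q" for p q
    proof -
      have "disjoint Q" "disjoint R" using pQ pR by (auto dest: partition_onD2)
      then have "disjnt p q" if "p \<in> Q \<and> q \<in> Q \<or> p \<in> R \<and> q \<in> R"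
        using that \<open>p \<noteq> q\<close> by (auto simp: disjnt_def dest: disjointD)
      moreover have "disjnt B C" if "B \<in> Q" "C \<in> R" for B C
        using QS(1)[OF that(1)] RX(1)[OF that(2)] by (auto simp: disjnt_iff)
      ultimately show ?thesis using that by (metis Un_iff disjnt_sym)
    qed
  qed
  moreover have "S \<union> ?X = {1..n}" using S by blast
  moreover have "noncrossing (Q \<union> R)"
  proof (rule noncrossingI)
    fix B C p1 q1 p2 q2
    assume BC: "B \<in> Q \<union> R" "C \<in> Q \<union> R" "B \<noteq> C"
      and i: "p1 \<in> B" "q1 \<in> C" "p2 \<in> B" "q2 \<in> C"
      and less: "p1 < q1" "q1 < p2" "p2 < q2"
    have inR: False if J: "J \<in> runs ?X" "B \<subseteq> J" "C \<subseteq> J" for J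
    proof -
      have "J \<subseteq> ?X" using J(1) by (rule run_subset)
      then have "B \<in> R" "C \<in> R" using BC QS J by blast+
      moreover have "noncrossing {B \<in> R. B \<subseteq> J}" using R J(1) by (simp add: ncu_def)
      ultimately show False
        using J less noncrossingD[of "{B \<in> R. B \<subseteq> J}", OF _ _ _ BC(3) i] by simp
    qed
    have QC: "D \<in> R" if "D \<in> Q \<union> R" "J \<in> runs ?X" "x \<in> D" "x \<in> J" for D J x
      using that QS(1) run_subset[OF that(2)] by blast
    \<comment> \<open>In \<open>p1 < q1 < p2 < q2\<close> the point \<open>q1\<close> lies between
      two points of \<open>B\<close>, and \<open>p2\<close> between two points of \<open>C\<close>.
      So the run holding one of the blocks catches the other, and \<open>inR\<close>
      applies.\<close>
    consider "B \<in> Q" "C \<in> Q" | "B \<in> R" | "C \<in> R" using BC by blast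
    then show False
    proof cases
      case 1
      then show False using Q less noncrossingD[of Q, OF _ _ _ BC(3) i] by (simp add: ncp_def)
    next
      case 2
      then obtain J where J: "J \<in> runs ?X" "B \<subseteq> J" using run by blast
      then have "q1 \<in> J" using runs_interval[of J ?X p1 p2 q1] i less by auto
      then have "C \<subseteq> J" using same[OF QC] BC J i by blast
      then show False using inR J by blast
    next
      case 3
      then obtain J where J: "J \<in> runs ?X" "C \<subseteq> J" using run by blast
      then have "p2 \<in> J" using runs_interval[of J ?X q1 q2 p2] i less by auto
      then have "B \<subseteq> J" using same[OF QC] BC J i by blast
      then show False using inR J by blast
    qed
  qed
  ultimately show "Q \<union> R \<in> NC n" by (simp add: NC_def)
  have "\<not> nested_in B C" if B: "B \<in> Q" and C: "C \<in> R" for B C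
  proof
    assume n: "nested_in B C"
    obtain x where x: "x \<in> B" using QS(2)[OF B] by blast
    obtain J where J: "J \<in> runs ?X" "C \<subseteq> J" using run[OF C] by blast
    have "finite C" using J finite_run finite_subset by blast
    then have "Min C \<in> C" "Max C \<in> C" using RX(2)[OF C] by auto
    then have "Min C \<in> J" "Max C \<in> J" using J(2) by auto
    then have "x \<in> J" using n x runs_interval[OF J(1), of "Min C" "Max C" x]
      by (auto simp: nested_in_def)
    then show False using run_subset[OF J(1)] QS(1)[OF B] x by blast
  qed
  then show "admissible (Q \<union> R) Q" by (auto simp: admissible_def)
qed

lemma finite_NC: "finite (NC n)"
  by (simp add: NC_eq_ncp finite_ncp)

lemma finite_admissible: "L \<in> NC n \<Longrightarrow> finite {Q. admissible L Q \<and> C Q}"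
  by (rule finite_subset[of _ "Pow L"])
    (auto simp: admissible_def NC_def intro: finite_elements[of "{1..n}"])

text \<open>The condition \<open>C\<close> sees \<open>Q\<close> only through its union, so the same
  reindexing serves the full coproduct and both halves.\<close>

lemma sum_admissible:
  fixes h :: "nat set set \<Rightarrow> nat set set \<Rightarrow> 'b::comm_monoid_add"
  shows "(\<Sum>L\<in>NC n. \<Sum>Q\<in>{Q. admissible L Q \<and> C (\<Union>Q)}. h L Q) =
    (\<Sum>S\<in>{S. S \<subseteq> {1..n} \<and> C S}. \<Sum>Q\<in>ncp S. \<Sum>R\<in>ncu (runs ({1..n} - S)). h (Q \<union> R) Q)"
proof -
  have fin: "finite {S. S \<subseteq> {1..n} \<and> C S}" by simp
  have "(\<Sum>L\<in>NC n. \<Sum>Q\<in>{Q. admissible L Q \<and> C (\<Union>Q)}. h L Q)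
    = (\<Sum>(L, Q)\<in>Sigma (NC n) (\<lambda>L. {Q. admissible L Q \<and> C (\<Union>Q)}). h L Q)"
    by (intro sum.Sigma finite_NC ballI finite_admissible[where C = "\<lambda>Q. C (\<Union>Q)"])
  also have "\<dots> = (\<Sum>(S, Q, R)\<in>Sigma {S. S \<subseteq> {1..n} \<and> C S}
      (\<lambda>S. ncp S \<times> ncu (runs ({1..n} - S))). h (Q \<union> R) Q)"
  proof (rule sum.reindex_bij_witness[where i = "\<lambda>(S, Q, R). (Q \<union> R, Q)"
        and j = "\<lambda>(L, Q). (\<Union>Q, Q, L - Q)"], goal_cases)
    case (1 a)
    then show ?case by (auto simp: admissible_def)
  next
    case (2 a)
    then obtain L Q where a: "a = (L, Q)" "L \<in> NC n" "admissible L Q" "C (\<Union>Q)" by auto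
    then show ?case using admissible_split[OF a(2,3)] by simp
  next
    case (3 b)
    then obtain S Q R where b: "b = (S, Q, R)" "S \<subseteq> {1..n}" "Q \<in> ncp S"
      "R \<in> ncu (runs ({1..n} - S))" by auto
    then show ?case using admissible_join[OF b(2-4)] by (simp add: Union_ncp)
  next
    case (4 b)
    then obtain S Q R where b: "b = (S, Q, R)" "S \<subseteq> {1..n}" "C S" "Q \<in> ncp S"
      "R \<in> ncu (runs ({1..n} - S))" by auto
    then show ?case using admissible_join[OF b(2,4,5)] by (simp add: Union_ncp)
  next
    case (5 a)
    then show ?case by (auto simp: admissible_def Un_absorb1)
  qed
  also have "\<dots> = (\<Sum>S\<in>{S. S \<subseteq> {1..n} \<and> C S}.
      \<Sum>(Q, R)\<in>ncp S \<times> ncu (runs ({1..n} - S)). h (Q \<union> R) Q)"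
  proof -
    have "finite (ncp S \<times> ncu (runs ({1..n} - S)))" if "S \<subseteq> {1..n}" for S
      using finite_subset[OF that] by (simp add: finite_ncp finite_ncu Union_runs)
    then show ?thesis using fin by (subst sum.Sigma) (auto simp: case_prod_unfold)
  qed
  finally show ?thesis by (simp add: sum.cartesian_product)
qed

section \<open>The splitting map and the coproducts\<close>

text \<open>\<open>Sp\<close> sums over partitions of renumbered positions; \<open>st\<close> turns
  this into a sum over partitions of the original positions, where they can be reassembled with
  other blocks.\<close>

lemma Sp_word_subword:
  assumes "S \<subseteq> {1..length w}"
  shows "Sp_word (subword w S) = (\<Sum>P\<in>ncp S. gen [(st P, subword w S)])"
proof -
  have fin: "finite S" using assms by (rule finite_subset) simp
  have "length (subword w S) = card S"
    using assms by (simp add: length_subword Int_absorb2)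
  then have "Sp_word (subword w S) = (\<Sum>L\<in>NC (card S). gen [(L, subword w S)])"
    by (simp only: Sp_word_def)
  also have "\<dots> = (\<Sum>P\<in>ncp S. gen [(st P, subword w S)])"
    by (rule sum.reindex_bij_betw[OF bij_betw_st[OF fin], symmetric])
  finally show ?thesis .
qed

lemma ev_Sp_bar_Cons:
  "ev \<phi> (Sp_bar (w # ws)) = (\<Sum>L\<in>NC (length w). ev (\<lambda>xs. \<phi> ((L, w) # xs)) (Sp_bar ws))"
  by (simp add: ev_bilin_ext Sp_word_def ev_sum)

lemma ev_Sp_bar_append:
  "ev \<phi> (Sp_bar (ws @ vs)) = ev (\<lambda>xs. ev (\<lambda>ys. \<phi> (xs @ ys)) (Sp_bar vs)) (Sp_bar ws)"
proof (induction ws arbitrary: \<phi>)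
  case Nil
  show ?case by simp
next
  case (Cons w ws)
  then show ?case by (simp only: append_Cons ev_Sp_bar_Cons)
qed

text \<open>The intervals are partitioned independently. Collecting the choices in one set
  \<open>R\<close> matches the shape in which \<open>L - Q\<close> comes out of an admissible
  decomposition.\<close>

lemma ev_Sp_bar_subwords:
  fixes \<phi> :: "(nat set set \<times> 'a list) list \<Rightarrow> 'k::field_char_0"
  assumes "distinct Js" "disjoint (set Js)" "\<And>J. J \<in> set Js \<Longrightarrow> J \<subseteq> {1..length w}"
  shows "ev \<phi> (Sp_bar (map (subword w) Js)) =
    (\<Sum>R\<in>ncu (set Js). \<phi> (map (\<lambda>J. (st {B \<in> R. B \<subseteq> J}, subword w J)) Js))"
  using assms
proof (induction Js arbitrary: \<phi>)
  case Nil
  show ?case by (simp add: ncu_empty)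
next
  case (Cons J Js)
  have d: "disjoint (insert J (set Js))" and J: "J \<notin> set Js" using Cons.prems by simp_all
  let ?t = "\<lambda>R. map (\<lambda>J. (st {B \<in> R. B \<subseteq> J}, subword w J)) Js"
  let ?f = "\<lambda>R. \<phi> (map (\<lambda>J. (st {B \<in> R. B \<subseteq> J}, subword w J)) (J # Js))"
  have "disjoint (set Js)" using d by (rule pairwise_subset) auto
  then have IH: "ev \<psi> (Sp_bar (map (subword w) Js)) = (\<Sum>R\<in>ncu (set Js). \<psi> (?t R))"
    for \<psi> :: "_ \<Rightarrow> 'k"
    using Cons by simp
  have "ev \<phi> (Sp_bar (map (subword w) (J # Js)))
    = (\<Sum>P\<in>ncp J. \<Sum>R\<in>ncu (set Js). \<phi> ((st P, subword w J) # ?t R))"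
    using Cons.prems by (simp add: Sp_word_subword ev_bilin_ext ev_sum IH)
  also have "\<dots> = (\<Sum>P\<in>ncp J. \<Sum>R\<in>ncu (set Js). ?f (P \<union> R))"
  proof (intro sum.cong refl)
    fix P R assume PR: "P \<in> ncp J" "R \<in> ncu (set Js)"
    have "?t R = ?t (P \<union> R)"
      using ncu_insert(3)[OF d J PR] by (intro map_cong refl) (simp only:)
    moreover have "st P = st {B \<in> P \<union> R. B \<subseteq> J}" using ncu_insert(2)[OF d J PR] by (simp only:)
    ultimately show "\<phi> ((st P, subword w J) # ?t R) = ?f (P \<union> R)"
      by (simp only: list.map)
  qed
  also have "\<dots> = (\<Sum>R\<in>ncu (insert J (set Js)). ?f R)"
    unfolding sum.cartesian_product sum.reindex_bij_betw[OF ncu_insert(1)[OF d J], of ?f, symmetric]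
    by (simp only: case_prod_unfold)
  finally show ?case by (simp only: list.set)
qed

text \<open>\<open>Sp_tensor \<beta>\<close> is \<open>\<beta> \<circ> (Sp \<otimes> Sp)\<close>.\<close>

definition Sp_tensor ::
    "((nat set set \<times> 'a list) list \<times> (nat set set \<times> 'a list) list \<Rightarrow> 'k::field_char_0) \<Rightarrow>
     'a list list \<times> 'a list list \<Rightarrow> 'k" where
  "Sp_tensor \<beta> = (\<lambda>(ws, vs). ev (\<lambda>xs. ev (\<lambda>ys. \<beta> (xs, ys)) (Sp_bar vs)) (Sp_bar ws))"

lemma Sp_tensor_cop_term:
  fixes \<beta> :: "_ \<Rightarrow> 'k::field_char_0"
  assumes S: "S \<subseteq> {1..length w}"
  shows "(\<Sum>Q\<in>ncp S. \<Sum>R\<in>ncu (runs ({1..length w} - S)). \<beta> (cop_NC_term (Q \<union> R, w) Q))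
    = Sp_tensor \<beta> (cop_term w S)"
proof -
  let ?X = "{1..length w} - S"
  let ?r = "\<lambda>R. map (\<lambda>J. (st {B \<in> R. B \<subseteq> J}, subword w J)) (runs_list ?X)"
  have runs: "ev \<phi> (Sp_bar (map (subword w) (runs_list ?X))) = (\<Sum>R\<in>ncu (runs ?X). \<phi> (?r R))"
    for \<phi> :: "_ \<Rightarrow> 'k"
  proof -
    have "J \<subseteq> {1..length w}" if "J \<in> runs ?X" for J using run_subset[OF that] by blast
    then show ?thesis
      using ev_Sp_bar_subwords[of "runs_list ?X" w \<phi>] by (simp add: distinct_runs_list disjoint_runs)
  qed
  have "cop_NC_term (Q \<union> R, w) Q = (if S = {} then [] else [(st Q, subword w S)], ?r R)"
    if "Q \<in> ncp S" "R \<in> ncu (runs ?X)" for Q R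
  proof -
    \<comment> \<open>The two coproduct terms test emptiness of different sets, \<open>Q\<close> and
      \<open>S\<close>; the tests agree because blocks are nonempty.\<close>
    have "Q = {} \<longleftrightarrow> S = {}" using Union_ncp[OF that(1)] ncp_block_nonempty[OF that(1)] by auto
    then show ?thesis
      using admissible_join(3)[OF S that] Union_ncp[OF that(1)]
      by (simp only: cop_NC_term_def prod.case)
  qed
  then have "(\<Sum>Q\<in>ncp S. \<Sum>R\<in>ncu (runs ?X). \<beta> (cop_NC_term (Q \<union> R, w) Q))
    = (\<Sum>Q\<in>ncp S. \<Sum>R\<in>ncu (runs ?X). \<beta> (if S = {} then [] else [(st Q, subword w S)], ?r R))"
    by (intro sum.cong refl) simp
  also have "\<dots> = ev (\<lambda>xs. \<Sum>R\<in>ncu (runs ?X). \<beta> (xs, ?r R)) (Sp_bar (if S = {} then [] else [subword w S]))"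
  proof (cases "S = {}")
    case True
    \<comment> \<open>With \<open>S\<close> empty the left leg is the empty bar word, not a letter
      carrying the empty word; the unique partition of the empty set gives exactly one
      summand.\<close>
    have "ncp {} = {{}}" by (auto simp: ncp_def partition_on_empty noncrossing_def)
    then show ?thesis by (simp add: True)
  next
    case False
    then show ?thesis by (simp add: Sp_word_subword[OF S] ev_bilin_ext ev_sum)
  qed
  also have "\<dots> = Sp_tensor \<beta> (cop_term w S)"
    by (simp only: Sp_tensor_def cop_term_def prod.case runs)
  finally show ?thesis .
qed

lemma Sp_tensor_cop_sum:
  "(\<Sum>L\<in>NC (length w). \<Sum>Q\<in>{Q. admissible L Q \<and> C (\<Union>Q)}. \<beta> (cop_NC_term (L, w) Q))
    = (\<Sum>S\<in>{S. S \<subseteq> {1..length w} \<and> C S}. Sp_tensor \<beta> (cop_term w S))"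
  unfolding sum_admissible[where C = C and h = "\<lambda>L Q. \<beta> (cop_NC_term (L, w) Q)"]
  by (intro sum.cong refl Sp_tensor_cop_term) simp

lemma Sp_tensor_cop_A: "(\<Sum>L\<in>NC (length w). ev \<beta> (cop_NC (L, w))) = ev (Sp_tensor \<beta>) (cop_A w)"
  using Sp_tensor_cop_sum[where w = w and C = "\<lambda>_. True" and \<beta> = \<beta>] by (simp add: cop_NC_def cop_A_def ev_sum)

lemma Sp_tensor_cop_A_prec:
  "(\<Sum>L\<in>NC (length w). ev \<beta> (cop_NC_prec (L, w))) = ev (Sp_tensor \<beta>) (cop_A_prec w)"
  using Sp_tensor_cop_sum[where w = w and C = "\<lambda>S. 1 \<in> S" and \<beta> = \<beta>] by (simp add: cop_NC_prec_def cop_A_prec_def ev_sum)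

text \<open>The block of 1 lies outside \<open>Q\<close> iff 1 is not in \<Union>Q, provided that 1
  is a position at all. For the empty word the left side is an empty sum while the right side has
  the term of the empty set.\<close>

lemma Sp_tensor_cop_A_succ:
  assumes "w \<noteq> []"
  shows "(\<Sum>L\<in>NC (length w). ev \<beta> (cop_NC_succ (L, w))) = ev (Sp_tensor \<beta>) (cop_A_succ w)"
proof -
  have "{Q. admissible L Q \<and> (\<exists>B\<in>L - Q. 1 \<in> B)} = {Q. admissible L Q \<and> 1 \<notin> \<Union>Q}"
    if L: "L \<in> NC (length w)" for L
  proof (intro Collect_cong conj_cong refl)
    fix Q assume adm: "admissible L Q"
    have L': "L \<in> ncp {1..length w}" using L by (simp add: NC_eq_ncp)
    have QL: "Q \<subseteq> L" using adm by (simp add: admissible_def)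
    have "1 \<in> \<Union>L" using assms Union_ncp[OF L'] by (simp add: Suc_le_eq)
    then show "(\<exists>B\<in>L - Q. 1 \<in> B) \<longleftrightarrow> 1 \<notin> \<Union>Q"
      using ncp_same_block[OF L'] QL by blast
  qed
  then show ?thesis
    using Sp_tensor_cop_sum[where w = w and C = "\<lambda>S. 1 \<notin> S" and \<beta> = \<beta>] by (simp add: cop_NC_succ_def cop_A_succ_def ev_sum)
qed

section \<open>Multiplicative extension to bar words\<close>

abbreviation bar_mult :: "'x list \<times> 'x list \<Rightarrow> 'x list \<times> 'x list \<Rightarrow> 'x list \<times> 'x list" where
  "bar_mult \<equiv> \<lambda>(u, v) (u', v'). (u @ u', v @ v')"

text \<open>\<open>Sp\<close> is multiplicative on each leg, so the pairing with a product is an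
  iterated pairing; what remains is to exchange the two middle factors.\<close>

lemma Sp_tensor_bar_mult:
  "Sp_tensor \<beta> (bar_mult z z') = Sp_tensor (\<lambda>x. Sp_tensor (\<lambda>y. \<beta> (bar_mult x y)) z') z"
proof -
  obtain u v u' v' where z: "z = (u, v)" "z' = (u', v')" by (metis surj_pair)
  have "Sp_tensor \<beta> (bar_mult z z') = ev (\<lambda>a. ev (\<lambda>a'. ev (\<lambda>b. ev (\<lambda>b'. \<beta> (a @ a', b @ b'))
    (Sp_bar v')) (Sp_bar v)) (Sp_bar u')) (Sp_bar u)"
    by (simp add: z Sp_tensor_def ev_Sp_bar_append)
  also have "\<dots> = ev (\<lambda>a. ev (\<lambda>b. ev (\<lambda>a'. ev (\<lambda>b'. \<beta> (a @ a', b @ b'))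
    (Sp_bar v')) (Sp_bar u')) (Sp_bar v)) (Sp_bar u)"
    by (subst ev_swap[of _ "Sp_bar v" "Sp_bar u'"]) (rule refl)
  finally show ?thesis by (simp add: z Sp_tensor_def)
qed

lemma Sp_tensor_ev: "Sp_tensor (\<lambda>x. ev (\<gamma> x) p) z = ev (\<lambda>y. Sp_tensor (\<lambda>x. \<gamma> x y) z) p"
proof -
  obtain u v where z: "z = (u, v)" by (metis surj_pair)
  have "Sp_tensor (\<lambda>x. ev (\<gamma> x) p) z = ev (\<lambda>a. ev (\<lambda>b. ev (\<lambda>y. \<gamma> (a, b) y) p) (Sp_bar v)) (Sp_bar u)"
    by (simp add: z Sp_tensor_def)
  also have "\<dots> = ev (\<lambda>a. ev (\<lambda>y. ev (\<lambda>b. \<gamma> (a, b) y) (Sp_bar v)) p) (Sp_bar u)"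
    by (subst ev_swap[of _ p "Sp_bar v"]) (rule refl)
  also have "\<dots> = ev (\<lambda>y. ev (\<lambda>a. ev (\<lambda>b. \<gamma> (a, b) y) (Sp_bar v)) (Sp_bar u)) p"
    by (rule ev_swap)
  finally show ?thesis by (simp add: z Sp_tensor_def)
qed

lemma ev_mult_tensor:
  "ev \<beta> (mult_tensor p q) = ev (\<lambda>x. ev (\<lambda>y. \<beta> (bar_mult x y)) q) p"
  by (rule ev_bilin_ext)

text \<open>Leaves the coproduct of the first letter open and fixes the full coproduct on the tail,
  so that it serves both the induction for \<open>cop_bar\<close> and the single step for
  \<open>cop_half\<close>.\<close>

lemma Sp_tensor_Cons:
  assumes F: "\<And>x xs. F (x # xs) = ev \<beta> (mult_tensor (\<delta> x) (cop_bar cop_NC xs))"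
    and w: "\<And>\<beta>. (\<Sum>L\<in>NC (length w). ev \<beta> (\<delta> (L, w))) = ev (Sp_tensor \<beta>) \<delta>w"
    and ws: "\<And>\<beta>. ev (\<lambda>xs. ev \<beta> (cop_bar cop_NC xs)) (Sp_bar ws) = ev (Sp_tensor \<beta>) p"
  shows "ev F (Sp_bar (w # ws)) = ev (Sp_tensor \<beta>) (mult_tensor \<delta>w p)"
proof -
  have "ev F (Sp_bar (w # ws)) = (\<Sum>L\<in>NC (length w).
    ev (\<lambda>xs. ev (\<lambda>x. ev (\<lambda>y. \<beta> (bar_mult x y)) (cop_bar cop_NC xs)) (\<delta> (L, w))) (Sp_bar ws))"
    by (simp only: ev_Sp_bar_Cons F ev_mult_tensor)
  also have "\<dots> = (\<Sum>L\<in>NC (length w).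
    ev (\<lambda>x. ev (\<lambda>xs. ev (\<lambda>y. \<beta> (bar_mult x y)) (cop_bar cop_NC xs)) (Sp_bar ws)) (\<delta> (L, w)))"
    by (intro sum.cong refl ev_swap)
  also have "\<dots> = ev (Sp_tensor (\<lambda>x. ev (Sp_tensor (\<lambda>y. \<beta> (bar_mult x y))) p)) \<delta>w"
    by (simp only: ws w)
  also have "\<dots> = ev (\<lambda>z. ev (\<lambda>z'. Sp_tensor \<beta> (bar_mult z z')) p) \<delta>w"
    by (intro ev_cong) (simp only: Sp_tensor_ev Sp_tensor_bar_mult)
  finally show ?thesis by (simp only: ev_mult_tensor)
qed

lemma Sp_tensor_cop_bar:
  "ev (\<lambda>xs. ev \<beta> (cop_bar cop_NC xs)) (Sp_bar ws) = ev (Sp_tensor \<beta>) (cop_bar cop_A ws)"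
proof (induction ws arbitrary: \<beta>)
  case Nil
  show ?case by (simp add: Sp_tensor_def)
next
  case (Cons w ws)
  show ?case
    unfolding cop_bar.simps by (rule Sp_tensor_Cons[OF _ Sp_tensor_cop_A Cons]) simp
qed

lemma Sp_tensor_cop_half:
  assumes "\<And>\<beta> w. w \<noteq> [] \<Longrightarrow> (\<Sum>L\<in>NC (length w). ev \<beta> (\<delta>N (L, w))) = ev (Sp_tensor \<beta>) (\<delta>A w)"
    and "[] \<notin> set ws"
  shows "ev (\<lambda>xs. ev \<beta> (cop_half \<delta>N cop_NC xs)) (Sp_bar ws) = ev (Sp_tensor \<beta>) (cop_half \<delta>A cop_A ws)"
proof (cases ws)
  case Nil
  then show ?thesis by simp
next
  case (Cons w vs)
  then have "w \<noteq> []" using assms(2) by auto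
  then show ?thesis
    unfolding Cons cop_half.simps by (intro Sp_tensor_Cons[OF _ assms(1) Sp_tensor_cop_bar]) simp_all
qed

text \<open>\<open>cop_prec\<close> and \<open>cop_succ\<close> branch on the empty bar word; this
  keeps a word and all terms of its splitting in the same branch.\<close>

lemma keys_Sp_bar_Nil: "[] \<in> Poly_Mapping.keys (Sp_bar ws) \<longleftrightarrow> ws = []"
proof (cases ws)
  case (Cons w vs)
  then have "Poly_Mapping.lookup (Sp_bar ws) [] = 0"
    unfolding lookup_eq_ev by (simp add: ev_Sp_bar_Cons del: Sp_bar.simps) (simp add: ev_def)
  then show ?thesis by (simp add: Cons in_keys_iff del: Sp_bar.simps)
qed simp

lemma Sp_tensor_cop_prec:
  assumes "[] \<notin> set ws"
  shows "ev (\<lambda>xs. ev \<beta> (cop_prec cop_NC_prec cop_NC xs)) (Sp_bar ws)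
    = ev (Sp_tensor \<beta>) (cop_prec cop_A_prec cop_A ws)"
proof (cases "ws = []")
  case False
  then have "ev (\<lambda>xs. ev \<beta> (cop_prec cop_NC_prec cop_NC xs)) (Sp_bar ws)
    = ev (\<lambda>xs. ev \<beta> (cop_half cop_NC_prec cop_NC xs) - \<beta> (xs, [])) (Sp_bar ws)"
    by (intro ev_cong) (auto simp: cop_prec_def ev_diff keys_Sp_bar_Nil)
  then show ?thesis using False assms
    by (simp add: ev_fun_diff Sp_tensor_cop_half Sp_tensor_cop_A_prec cop_prec_def ev_diff Sp_tensor_def)
qed (simp add: cop_prec_def)

lemma Sp_tensor_cop_succ:
  assumes "[] \<notin> set ws"
  shows "ev (\<lambda>xs. ev \<beta> (cop_succ cop_NC_succ cop_NC xs)) (Sp_bar ws)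
    = ev (Sp_tensor \<beta>) (cop_succ cop_A_succ cop_A ws)"
proof (cases "ws = []")
  case False
  then have "ev (\<lambda>xs. ev \<beta> (cop_succ cop_NC_succ cop_NC xs)) (Sp_bar ws)
    = ev (\<lambda>xs. ev \<beta> (cop_half cop_NC_succ cop_NC xs) - \<beta> ([], xs)) (Sp_bar ws)"
    by (intro ev_cong) (auto simp: cop_succ_def ev_diff keys_Sp_bar_Nil)
  then show ?thesis using False assms
    by (simp add: ev_fun_diff Sp_tensor_cop_half Sp_tensor_cop_A_succ cop_succ_def ev_diff Sp_tensor_def)
qed (simp add: cop_succ_def)

section \<open>Functionals that are linear in each decoration\<close>

definition klin :: "('k::field_char_0 \<Rightarrow> 'a::{ring, monoid_mult} \<Rightarrow> 'a) \<Rightarrow> ('a \<Rightarrow> 'k) \<Rightarrow> bool" where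
  "klin scale G \<longleftrightarrow> (\<forall>a b. G (a + b) = G a + G b) \<and> (\<forall>c a. G (scale c a) = c * G a)"

lemma klin_zero: "klin scale (\<lambda>a. 0)"
  by (simp add: klin_def)

lemma klin_diff: "klin scale G \<Longrightarrow> klin scale G' \<Longrightarrow> klin scale (\<lambda>a. G a - G' a)"
  by (simp add: klin_def algebra_simps)

lemma klin_mult_left: "klin scale G \<Longrightarrow> klin scale (\<lambda>a. c * G a)"
  by (simp add: klin_def algebra_simps)

lemma klin_mult_right: "klin scale G \<Longrightarrow> klin scale (\<lambda>a. G a * c)"
  by (simp add: klin_def algebra_simps)

lemma klin_sum: "(\<And>i. i \<in> I \<Longrightarrow> klin scale (G i)) \<Longrightarrow> klin scale (\<lambda>a. \<Sum>i\<in>I. G i a)"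
  by (simp add: klin_def sum.distrib sum_distrib_left)

lemma klin_ev:
  "(\<And>w. w \<in> Poly_Mapping.keys p \<Longrightarrow> klin scale (\<lambda>a. G a w)) \<Longrightarrow> klin scale (\<lambda>a. ev (G a) p)"
  unfolding ev_def by (intro klin_sum klin_mult_left)

lemma compatible_space_pres: "compatible (space_pres scale) G \<longleftrightarrow> klin scale G"
proof -
  have "ev G (gen (a + b) - gen a - gen b) = G (a + b) - (G a + G b)"
    "ev G (gen (scale c a) - smul c (gen a)) = G (scale c a) - c * G a" for a b c
    by (simp_all add: ev_diff ev_smul)
  then show ?thesis
    unfolding compatible_def space_pres_def klin_def by (auto simp: ball_Un) (metis eq_iff_diff_eq_0)+
qed

lemma gens_TA: "gens (TA scale) = {w. w \<noteq> []}"
  by (auto simp: TA_def tensor_alg_pos_def tensor_alg_def space_pres_def)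

lemma rels_TA: "rels (TA scale) = {lin_ext (\<lambda>x. gen (u @ x # v)) r | u v r. r \<in> rels (space_pres scale)}"
  by (auto simp: TA_def tensor_alg_pos_def tensor_alg_def space_pres_def)

lemma compatible_TA: "compatible (TA scale) \<phi> \<longleftrightarrow> (\<forall>u v. klin scale (\<lambda>a. \<phi> (u @ a # v)))"
proof -
  have "compatible (TA scale) \<phi> \<longleftrightarrow> compatible (tensor_alg (space_pres scale)) \<phi>"
    by (simp add: TA_def tensor_alg_pos_def compatible_def)
  moreover have "gens (space_pres scale) = UNIV" by (simp add: space_pres_def)
  ultimately show ?thesis by (simp add: compatible_tensor_alg compatible_space_pres)
qed

lemma gens_NCA: "gens (NCA scale) = {(L, w). w \<noteq> [] \<and> L \<in> NC (length w)}"
  by (simp add: NCA_def gens_TA)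

text \<open>A relation of \<open>A\<close> placed between \<open>u\<close> and \<open>v\<close> is
  homogeneous of degree \<open>length u + Suc (length v)\<close>, which must be the size of the
  ground set of \<open>L\<close>. So the degree condition in \<open>NCA\<close> only matches
  partitions with words.\<close>

lemma compatible_NCA:
  "compatible (NCA scale) \<phi> \<longleftrightarrow>
    (\<forall>u v. \<forall>L\<in>NC (length u + Suc (length v)). klin scale (\<lambda>a. \<phi> (L, u @ a # v)))"
  (is "?l \<longleftrightarrow> ?r")
proof
  assume l: ?l
  have "ev (\<lambda>a. \<phi> (L, u @ a # v)) r = 0"
    if L: "L \<in> NC (length u + Suc (length v))" and r: "r \<in> rels (space_pres scale)" for u v L r
  proof -
    let ?r = "lin_ext (\<lambda>x. gen (u @ x # v)) r"
    have "?r \<in> rels (TA scale)" unfolding rels_TA using r by blast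
    moreover have "?r \<in> free_on {w. length w = length u + Suc (length v)}"
      by (rule free_on_lin_ext[of _ UNIV]) (auto simp: free_on_def)
    ultimately have "lin_ext (\<lambda>w. gen (L, w)) ?r \<in> rels (NCA scale)"
      unfolding NCA_def presentation.simps using L by fastforce
    then have "ev \<phi> (lin_ext (\<lambda>w. gen (L, w)) ?r) = 0" using l unfolding compatible_def by blast
    then show ?thesis by (simp add: ev_lin_ext)
  qed
  then show ?r unfolding compatible_space_pres[symmetric] compatible_def by blast
next
  assume r: ?r
  show ?l
    unfolding compatible_def
  proof
    fix t assume "t \<in> rels (NCA scale)"
    then obtain L s n where t: "t = lin_ext (\<lambda>w. gen (L, w)) s" and L: "L \<in> NC n"
      and s: "s \<in> rels (TA scale)" "s \<in> free_on {w. length w = n}"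
      unfolding NCA_def by auto
    obtain u v r0 where s0: "s = lin_ext (\<lambda>x. gen (u @ x # v)) r0" and r0: "r0 \<in> rels (space_pres scale)"
      using s(1) unfolding rels_TA by blast
    show "ev \<phi> t = 0"
    \<comment> \<open>The zero relation is homogeneous of every degree, so \<open>n\<close> can be
      read off only from a nonzero \<open>s\<close>.\<close>
    proof (cases "s = 0")
      case True
      then show ?thesis by (simp add: t ev_lin_ext)
    next
      case False
      then obtain w where w: "w \<in> Poly_Mapping.keys s" by (metis all_not_in_conv keys_eq_empty)
      have "s \<in> free_on {w. length w = length u + Suc (length v)}"
        unfolding s0 by (rule free_on_lin_ext[of _ UNIV]) (auto simp: free_on_def)
      then have "n = length u + Suc (length v)" using w s(2) by (auto simp: free_on_def)
      then have "klin scale (\<lambda>a. \<phi> (L, u @ a # v))" using r L by blast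
      then have "ev (\<lambda>a. \<phi> (L, u @ a # v)) r0 = 0"
        using r0 unfolding compatible_space_pres[symmetric] compatible_def by blast
      then show ?thesis by (simp add: t s0 ev_lin_ext)
    qed
  qed
qed

lemma gens_TTA: "gens (TTA scale) = lists (gens (TA scale))"
  by (simp add: TTA_def tensor_alg_def)

lemma gens_TNCA: "gens (TNCA scale) = lists (gens (NCA scale))"
  by (simp add: TNCA_def tensor_alg_def)

lemma rels_tensor_alg_free:
  assumes "rels V \<subseteq> free_on (gens V)"
  shows "rels (tensor_alg V) \<subseteq> free_on (gens (tensor_alg V))"
proof
  fix t assume "t \<in> rels (tensor_alg V)"
  then obtain u v r where "t = lin_ext (\<lambda>x. gen (u @ x # v)) r" "u \<in> lists (gens V)"
    "v \<in> lists (gens V)" "r \<in> rels V"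
    unfolding tensor_alg_def by auto
  then show "t \<in> free_on (gens (tensor_alg V))"
    using assms by (auto simp: tensor_alg_def intro!: free_on_lin_ext[of r "gens V"])
qed

lemma rels_TTA_free: "rels (TTA scale) \<subseteq> free_on (gens (TTA scale))"
  unfolding TTA_def
proof (intro rels_tensor_alg_free subsetI)
  fix t assume "t \<in> rels (TA scale)"
  then obtain u v r where t: "t = lin_ext (\<lambda>x. gen (u @ x # v)) r" unfolding rels_TA by blast
  show "t \<in> free_on (gens (TA scale))"
    unfolding t by (rule free_on_lin_ext[of _ UNIV]) (auto simp: free_on_def gens_TA)
qed

lemma rels_TNCA_free: "rels (TNCA scale) \<subseteq> free_on (gens (TNCA scale))"
  unfolding TNCA_def
proof (intro rels_tensor_alg_free subsetI)
  fix t assume "t \<in> rels (NCA scale)"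
  then obtain L r n where t: "t = lin_ext (\<lambda>w. gen (L, w)) r" "1 \<le> n" "L \<in> NC n"
    "r \<in> free_on {w. length w = n}"
    unfolding NCA_def by auto
  show "t \<in> free_on (gens (NCA scale))"
    unfolding t(1) by (rule free_on_lin_ext[OF t(4)]) (use t in \<open>auto simp: gens_NCA\<close>)
qed

lemma compatible_TTA:
  "compatible (TTA scale) \<phi> \<longleftrightarrow>
    (\<forall>p\<in>gens (TTA scale). \<forall>q\<in>gens (TTA scale). \<forall>u v. klin scale (\<lambda>a. \<phi> (p @ (u @ a # v) # q)))"
  unfolding gens_TTA unfolding TTA_def compatible_tensor_alg compatible_TA by (rule refl)

lemma compatible_TNCA:
  "compatible (TNCA scale) \<phi> \<longleftrightarrow>
    (\<forall>p\<in>gens (TNCA scale). \<forall>q\<in>gens (TNCA scale). \<forall>u v. \<forall>L\<in>NC (length u + Suc (length v)).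
      klin scale (\<lambda>a. \<phi> (p @ (L, u @ a # v) # q)))"
  unfolding gens_TNCA unfolding TNCA_def compatible_tensor_alg compatible_NCA by (rule refl)

lemma Sp_bar_free:
  fixes scale :: "'k::field_char_0 \<Rightarrow> 'a::{ring, monoid_mult} \<Rightarrow> 'a"
  assumes "ws \<in> gens (TTA scale)"
  shows "(Sp_bar ws :: _ \<Rightarrow>\<^sub>0 'k) \<in> free_on (gens (TNCA scale))"
  using assms unfolding gens_TTA gens_TNCA
proof (induction ws)
  case Nil
  show ?case by simp
next
  case (Cons w ws)
  have w: "w \<noteq> []" using Cons.hyps by (simp add: gens_TA)
  have "Sp_word w \<in> free_on (lists (gens (NCA scale)))"
    unfolding Sp_word_def by (intro free_on_sum) (simp add: gens_NCA w)
  then show ?case unfolding Sp_bar.simps using Cons.IH by (rule free_on_bilin_ext) simp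
qed

text \<open>The dual form of the fact that \<open>Sp\<close> is well defined on the quotient. The
  partitions summed over depend on word lengths only, so changing a decoration varies each summand
  linearly.\<close>

lemma compatible_Sp_bar:
  fixes scale :: "'k::field_char_0 \<Rightarrow> 'a::{ring, monoid_mult} \<Rightarrow> 'a"
  assumes "compatible (TNCA scale) \<phi>"
  shows "compatible (TTA scale) (\<lambda>ws. ev \<phi> (Sp_bar ws))"
  unfolding compatible_TTA
proof (intro ballI allI)
  fix p q u v assume pq: "p \<in> gens (TTA scale)" "q \<in> gens (TTA scale)"
  have *: "klin scale (\<lambda>a. \<phi> (xs @ (L, u @ a # v) # ys))"
    if "xs \<in> Poly_Mapping.keys (Sp_bar p :: _ \<Rightarrow>\<^sub>0 'k)" "ys \<in> Poly_Mapping.keys (Sp_bar q :: _ \<Rightarrow>\<^sub>0 'k)"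
      "L \<in> NC (length u + Suc (length v))" for xs ys L
    using assms that Sp_bar_free[OF pq(1)] Sp_bar_free[OF pq(2)]
    unfolding compatible_TNCA free_on_def by blast
  have e: "(\<lambda>a. ev \<phi> (Sp_bar (p @ (u @ a # v) # q)))
    = (\<lambda>a. ev (\<lambda>xs. \<Sum>L\<in>NC (length u + Suc (length v)).
        ev (\<lambda>ys. \<phi> (xs @ (L, u @ a # v) # ys)) (Sp_bar q)) (Sp_bar p))"
    by (simp add: ev_Sp_bar_append ev_Sp_bar_Cons del: Sp_bar.simps)
  show "klin scale (\<lambda>a. ev \<phi> (Sp_bar (p @ (u @ a # v) # q)))"
    unfolding e by (intro klin_ev klin_sum *)
qed

section \<open>Supports of the coproducts\<close>

lemma free_on_mult_tensor:
  assumes "p \<in> free_on (lists G \<times> lists G)" "q \<in> free_on (lists G \<times> lists G)"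
  shows "mult_tensor p q \<in> free_on (lists G \<times> lists G)"
  using assms by (rule free_on_bilin_ext) auto

lemma free_on_cop_bar:
  assumes "\<And>x. x \<in> G \<Longrightarrow> \<delta> x \<in> free_on (lists G \<times> lists G)" "xs \<in> lists G"
  shows "cop_bar \<delta> xs \<in> free_on (lists G \<times> lists G)"
  using assms(2) by (induction xs) (simp_all add: assms(1) free_on_mult_tensor del: lists_eq_set)

lemma free_on_cop_half:
  assumes "\<And>x. x \<in> G \<Longrightarrow> \<delta> x \<in> free_on (lists G \<times> lists G)"
    and "\<And>x. x \<in> G \<Longrightarrow> \<delta>h x \<in> free_on (lists G \<times> lists G)" "xs \<in> lists G"
  shows "cop_half \<delta>h \<delta> xs \<in> free_on (lists G \<times> lists G)"
  using assms(3)
  by (cases xs) (simp_all add: assms(1,2) free_on_cop_bar free_on_mult_tensor del: lists_eq_set)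

lemma free_on_cop_reduced:
  assumes "\<And>x. x \<in> G \<Longrightarrow> \<delta> x \<in> free_on (lists G \<times> lists G)"
    and "\<And>x. x \<in> G \<Longrightarrow> \<delta>h x \<in> free_on (lists G \<times> lists G)" "xs \<in> lists G"
  shows "cop_prec \<delta>h \<delta> xs \<in> free_on (lists G \<times> lists G)"
    and "cop_succ \<delta>h \<delta> xs \<in> free_on (lists G \<times> lists G)"
  using free_on_cop_half[of G \<delta> \<delta>h, OF assms] assms(3)
  by (simp_all add: cop_prec_def cop_succ_def free_on_diff del: lists_eq_set)

lemma subword_nonempty:
  assumes "S \<noteq> {}" "S \<subseteq> {1..length w}"
  shows "subword w S \<noteq> []"
proof -
  have "finite S" using assms(2) by (rule finite_subset) simp
  then have "length (subword w S) \<noteq> 0" using assms by (simp add: length_subword Int_absorb2)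
  then show ?thesis by auto
qed

lemma cop_term_gens:
  assumes "S \<subseteq> {1..length w}"
  shows "cop_term w S \<in> lists (gens (TA scale)) \<times> lists (gens (TA scale))"
proof -
  have "subword w J \<noteq> []" if "J \<in> runs ({1..length w} - S)" for J
    using subword_nonempty[OF run_nonempty[OF that]] run_subset[OF that] by blast
  then have "map (subword w) (runs_list ({1..length w} - S)) \<in> lists {w. w \<noteq> []}"
    unfolding lists_eq_set by auto
  then show ?thesis using subword_nonempty[OF _ assms] by (simp add: cop_term_def gens_TA)
qed

lemma cop_A_free:
  "cop_A w \<in> free_on (lists (gens (TA scale)) \<times> lists (gens (TA scale)))"
  "cop_A_prec w \<in> free_on (lists (gens (TA scale)) \<times> lists (gens (TA scale)))"
  "cop_A_succ w \<in> free_on (lists (gens (TA scale)) \<times> lists (gens (TA scale)))"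
  unfolding cop_A_def cop_A_prec_def cop_A_succ_def
  by (intro free_on_sum; unfold free_on_gen; intro cop_term_gens; blast)+

lemma decorated_block_gens:
  assumes "P \<in> ncp S" "S \<noteq> {}" "S \<subseteq> {1..length w}"
  shows "(st P, subword w S) \<in> gens (NCA scale)"
proof -
  have "finite S" using assms(3) by (rule finite_subset) simp
  then have "st P \<in> NC (card S)" using bij_betwE[OF bij_betw_st] assms(1) by blast
  moreover have "length (subword w S) = card S" using assms(3) by (simp add: length_subword Int_absorb2)
  ultimately show ?thesis using subword_nonempty[OF assms(2,3)] by (simp add: gens_NCA)
qed

lemma cop_NC_run_gens:
  assumes "L \<in> NC (length w)" "admissible L Q" "J \<in> runs ({1..length w} - \<Union>Q)"
  shows "(st {B \<in> L - Q. B \<subseteq> J}, subword w J) \<in> gens (NCA scale)"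
proof (rule decorated_block_gens)
  show "{B \<in> L - Q. B \<subseteq> J} \<in> ncp J"
    using admissible_split(3)[OF assms(1,2)] assms(3) disjoint_runs by (rule ncu_restrict)
  show "J \<noteq> {}" using assms(3) by (rule run_nonempty)
  show "J \<subseteq> {1..length w}" using run_subset[OF assms(3)] by blast
qed

lemma cop_NC_block_gens:
  assumes "L \<in> NC (length w)" "admissible L Q" "Q \<noteq> {}"
  shows "(st Q, subword w (\<Union>Q)) \<in> gens (NCA scale)"
proof (rule decorated_block_gens)
  show Q: "Q \<in> ncp (\<Union>Q)" and "\<Union>Q \<subseteq> {1..length w}" using admissible_split[OF assms(1,2)] by auto
  show "\<Union>Q \<noteq> {}" using ncp_block_nonempty[OF Q] assms(3) by blast
qed

lemma cop_NC_term_gens: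
  assumes "L \<in> NC (length w)" "admissible L Q"
  shows "cop_NC_term (L, w) Q \<in> lists (gens (NCA scale)) \<times> lists (gens (NCA scale))"
  using cop_NC_run_gens[OF assms, of _ scale] cop_NC_block_gens[OF assms, of scale]
  by (auto simp: cop_NC_term_def)

lemma cop_NC_free:
  assumes "x \<in> gens (NCA scale)"
  shows "cop_NC x \<in> free_on (lists (gens (NCA scale)) \<times> lists (gens (NCA scale)))"
    and "cop_NC_prec x \<in> free_on (lists (gens (NCA scale)) \<times> lists (gens (NCA scale)))"
    and "cop_NC_succ x \<in> free_on (lists (gens (NCA scale)) \<times> lists (gens (NCA scale)))"
proof -
  obtain L w where x: "x = (L, w)" "L \<in> NC (length w)" using assms by (auto simp: gens_NCA)
  note t = cop_NC_term_gens[OF x(2), of _ scale]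
  show "cop_NC x \<in> free_on (lists (gens (NCA scale)) \<times> lists (gens (NCA scale)))"
    "cop_NC_prec x \<in> free_on (lists (gens (NCA scale)) \<times> lists (gens (NCA scale)))"
    "cop_NC_succ x \<in> free_on (lists (gens (NCA scale)) \<times> lists (gens (NCA scale)))"
    unfolding cop_NC_def cop_NC_prec_def cop_NC_succ_def x(1) fst_conv
    by (intro free_on_sum; unfold free_on_gen; intro t; blast)+
qed

section \<open>Linearity of the coproduct terms in one decoration\<close>

lemma subword_insert:
  "subword (u @ a # v) S =
    subword u S @ (if Suc (length u) \<in> S then [a] else []) @ subword v {j. j + Suc (length u) \<in> S}"
  by (simp add: subword_def nths_append nths_Cons)

lemma subword_insert_cong:
  "Suc (length u) \<notin> S \<Longrightarrow> subword (u @ a # v) S = subword (u @ b # v) S"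
  by (simp add: subword_insert)

text \<open>The decoration at a given position of \<open>w\<close> occurs in exactly one letter of
  \<open>cop_NC_term (L, w) Q\<close>, so every term of the coproduct is linear in it.\<close>

lemma klin_cop_NC_term:
  fixes scale :: "'k::field_char_0 \<Rightarrow> 'a::{ring, monoid_mult} \<Rightarrow> 'a"
  assumes \<phi>: "compatible (TNCA scale) \<phi>" and \<psi>: "compatible (TNCA scale) \<psi>"
    and L: "L \<in> NC (length u + Suc (length v))" and adm: "admissible L Q"
    and z: "x1 \<in> gens (TNCA scale)" "x2 \<in> gens (TNCA scale)"
      "y1 \<in> gens (TNCA scale)" "y2 \<in> gens (TNCA scale)"
  shows "klin scale (\<lambda>a. \<phi> (x1 @ fst (cop_NC_term (L, u @ a # v) Q) @ x2)
    * \<psi> (y1 @ snd (cop_NC_term (L, u @ a # v) Q) @ y2))"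
proof -
  let ?n = "length u + Suc (length v)" and ?i = "Suc (length u)"
  let ?X = "{1..?n} - \<Union>Q"
  let ?g = "\<lambda>a J. (st {B \<in> L - Q. B \<subseteq> J}, subword (u @ a # v) J)"
  have L': "L \<in> NC (length (u @ a # v))" for a using L by simp
  have fst: "fst (cop_NC_term (L, u @ a # v) Q)
      = (if Q = {} then [] else [(st Q, subword (u @ a # v) (\<Union>Q))])" for a
    by (simp add: cop_NC_term_def)
  have snd: "snd (cop_NC_term (L, u @ a # v) Q) = map (?g a) (runs_list ?X)" for a
    by (simp add: cop_NC_term_def)
  have klin: "klin scale (\<lambda>a. \<chi> (p @ (M, subword (u @ a # v) S) # q))"
    if \<chi>: "compatible (TNCA scale) \<chi>" and S: "?i \<in> S" and pq: "p \<in> gens (TNCA scale)" "q \<in> gens (TNCA scale)"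
      and M: "\<And>a. (M, subword (u @ a # v) S) \<in> gens (NCA scale)" for \<chi> p q M S
  proof -
    let ?u = "subword u S" and ?v = "subword v {j. j + Suc (length u) \<in> S}"
    have e: "subword (u @ a # v) S = ?u @ a # ?v" for a by (simp add: subword_insert S)
    have "M \<in> NC (length ?u + Suc (length ?v))" using M[of 0] unfolding e by (simp add: gens_NCA)
    then show ?thesis unfolding e using \<chi> pq unfolding compatible_TNCA by blast
  qed
  show ?thesis
  proof (cases "?i \<in> \<Union>Q")
    case True
    then have ne: "Q \<noteq> {}" by auto
    have "?i \<notin> J" if "J \<in> set (runs_list ?X)" for J
      using that run_subset[of J ?X] True by auto
    \<comment> \<open>The position of \<open>a\<close> is used up by the left leg, so the right leg
      is constant in \<open>a\<close>; 0 is just a reference decoration at which it is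
      frozen.\<close>
    then have snd0: "snd (cop_NC_term (L, u @ a # v) Q) = snd (cop_NC_term (L, u @ 0 # v) Q)" for a
      unfolding snd
      by (intro map_cong refl arg_cong[where f = "Pair M" for M] subword_insert_cong)
    have "klin scale (\<lambda>a. \<phi> (x1 @ (st Q, subword (u @ a # v) (\<Union>Q)) # x2)
        * \<psi> (y1 @ snd (cop_NC_term (L, u @ 0 # v) Q) @ y2))"
      by (intro klin_mult_right klin \<phi> True z cop_NC_block_gens[OF L' adm ne])
    moreover have "\<phi> (x1 @ fst (cop_NC_term (L, u @ a # v) Q) @ x2)
        * \<psi> (y1 @ snd (cop_NC_term (L, u @ a # v) Q) @ y2)
      = \<phi> (x1 @ (st Q, subword (u @ a # v) (\<Union>Q)) # x2)
        * \<psi> (y1 @ snd (cop_NC_term (L, u @ 0 # v) Q) @ y2)" for a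
      by (subst snd0) (simp add: fst ne)
    ultimately show ?thesis by (simp only:)
  next
    case False
    have fst0: "fst (cop_NC_term (L, u @ a # v) Q) = fst (cop_NC_term (L, u @ 0 # v) Q)" for a
      unfolding fst by (simp add: subword_insert_cong[OF False, of a v 0])
    have "?i \<in> ?X" using False by simp
    then obtain J where J: "J \<in> runs ?X" "?i \<in> J" using Union_runs[of ?X] by blast
    then have "J \<in> set (runs_list ?X)" by simp
    \<comment> \<open>Exactly one run contains the position of \<open>a\<close>. The list of runs is
      cut there, and the entries on both sides are frozen at the reference decoration.\<close>
    then obtain Ks Ms where Js: "runs_list ?X = Ks @ J # Ms" by (meson split_list)
    have KM: "K \<in> runs ?X \<and> ?i \<notin> K" if "K \<in> set Ks \<union> set Ms" for K
    proof -
      have "K \<in> set (runs_list ?X)" unfolding Js using that by auto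
      then have K: "K \<in> runs ?X" by simp
      moreover have "K \<noteq> J" using that distinct_runs_list[of ?X] unfolding Js by auto
      ultimately show ?thesis using runs_eqI[OF K J(1) _ J(2)] by blast
    qed
    have run: "?g a K \<in> gens (NCA scale)" if "K \<in> runs ?X" for a K
      using cop_NC_run_gens[OF L' adm, of K a scale] that by simp
    have KM0: "map (?g a) Ks = map (?g 0) Ks" "map (?g a) Ms = map (?g 0) Ms" for a
      using KM by (auto intro!: subword_insert_cong)
    have "map (?g 0) Ks \<in> gens (TNCA scale)" "map (?g 0) Ms \<in> gens (TNCA scale)"
      using KM run unfolding gens_TNCA by auto
    then have pq: "y1 @ map (?g 0) Ks \<in> gens (TNCA scale)" "map (?g 0) Ms @ y2 \<in> gens (TNCA scale)"
      using z unfolding gens_TNCA by auto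
    have "klin scale (\<lambda>a. \<phi> (x1 @ fst (cop_NC_term (L, u @ 0 # v) Q) @ x2)
        * \<psi> ((y1 @ map (?g 0) Ks) @ ?g a J # map (?g 0) Ms @ y2))"
      by (intro klin_mult_left klin \<psi> J(2) pq run J(1))
    moreover have "\<phi> (x1 @ fst (cop_NC_term (L, u @ a # v) Q) @ x2)
        * \<psi> (y1 @ snd (cop_NC_term (L, u @ a # v) Q) @ y2)
      = \<phi> (x1 @ fst (cop_NC_term (L, u @ 0 # v) Q) @ x2)
        * \<psi> ((y1 @ map (?g 0) Ks) @ ?g a J # map (?g 0) Ms @ y2)" for a
      unfolding snd Js map_append list.map KM0[of a] by (subst fst0) simp
    ultimately show ?thesis by (simp only:)
  qed
qed

text \<open>The factors \<open>z\<close> and \<open>z'\<close> on either side make the condition stable under the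
  multiplications by which the coproduct is extended to bar words.\<close>

definition mlin :: "('k::field_char_0 \<Rightarrow> 'a::{ring, monoid_mult} \<Rightarrow> 'a) \<Rightarrow>
    ((nat set set \<times> 'a list) list \<times> (nat set set \<times> 'a list) list \<Rightarrow> 'k) \<Rightarrow> bool" where
  "mlin scale \<beta> \<longleftrightarrow> (\<forall>z\<in>gens (TNCA scale) \<times> gens (TNCA scale). \<forall>z'\<in>gens (TNCA scale) \<times> gens (TNCA scale).
     \<forall>u v. \<forall>L\<in>NC (length u + Suc (length v)). \<forall>Q. admissible L Q \<longrightarrow>
       klin scale (\<lambda>a. \<beta> (bar_mult z (bar_mult (cop_NC_term (L, u @ a # v) Q) z'))))"

lemma mlin_tensor:
  fixes scale :: "'k::field_char_0 \<Rightarrow> 'a::{ring, monoid_mult} \<Rightarrow> 'a"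
  assumes "compatible (TNCA scale) \<phi>" "compatible (TNCA scale) \<psi>"
  shows "mlin scale (\<lambda>(x, y). \<phi> x * \<psi> y)"
  unfolding mlin_def
proof (intro ballI allI impI)
  fix z z' and u v :: "'a list" and L Q
  assume z: "z \<in> gens (TNCA scale) \<times> gens (TNCA scale)" "z' \<in> gens (TNCA scale) \<times> gens (TNCA scale)"
    and L: "L \<in> NC (length u + Suc (length v))" and Q: "admissible L Q"
  obtain x1 y1 x2 y2 where e: "z = (x1, y1)" "z' = (x2, y2)" by (metis surj_pair)
  have "(case bar_mult z (bar_mult t z') of (x, y) \<Rightarrow> \<phi> x * \<psi> y)
    = \<phi> (x1 @ fst t @ x2) * \<psi> (y1 @ snd t @ y2)" for t
    by (simp add: e case_prod_unfold)
  moreover have "klin scale (\<lambda>a. \<phi> (x1 @ fst (cop_NC_term (L, u @ a # v) Q) @ x2)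
    * \<psi> (y1 @ snd (cop_NC_term (L, u @ a # v) Q) @ y2))"
    using z unfolding e by (intro klin_cop_NC_term assms L Q) auto
  ultimately show "klin scale (\<lambda>a. case bar_mult z (bar_mult (cop_NC_term (L, u @ a # v) Q) z')
    of (x, y) \<Rightarrow> \<phi> x * \<psi> y)"
    by (simp only:)
qed

text \<open>Associativity absorbs \<open>z\<close> into the left factor over which
  \<open>mlin\<close> quantifies.\<close>

lemma mlin_bar_mult:
  assumes "mlin scale \<beta>" "z \<in> gens (TNCA scale) \<times> gens (TNCA scale)"
  shows "mlin scale (\<lambda>y. \<beta> (bar_mult z y))"
proof -
  have "bar_mult z (bar_mult z0 y) = bar_mult (bar_mult z z0) y" for z0 y
    by (simp add: case_prod_unfold)
  moreover have "bar_mult z z0 \<in> gens (TNCA scale) \<times> gens (TNCA scale)"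
    if "z0 \<in> gens (TNCA scale) \<times> gens (TNCA scale)" for z0
    using that assms(2) by (auto simp: gens_TNCA)
  ultimately show ?thesis using assms(1) unfolding mlin_def by (simp only:) blast
qed

text \<open>The case in which the first letter is varied: the terms \<open>z\<close> of the tail are
  right factors in \<open>mlin\<close>. The sets \<open>Q\<close> summed over depend on
  \<open>L\<close> and not on the decorations, whatever the filter \<open>C\<close>.\<close>

lemma klin_letter:
  assumes \<beta>: "mlin scale \<beta>" and q: "q \<in> free_on (gens (TNCA scale) \<times> gens (TNCA scale))"
    and L: "L \<in> NC (length u + Suc (length v))"
    and \<delta>: "\<And>w. \<delta> (L, w) = (\<Sum>Q\<in>{Q. admissible L Q \<and> C Q}. gen (cop_NC_term (L, w) Q))"
  shows "klin scale (\<lambda>a. ev \<beta> (mult_tensor (\<delta> (L, u @ a # v)) q))"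
proof -
  have "klin scale (\<lambda>a. \<beta> (bar_mult (cop_NC_term (L, u @ a # v) Q) z))"
    if "admissible L Q" "z \<in> Poly_Mapping.keys q" for Q z
  proof -
    have "z \<in> gens (TNCA scale) \<times> gens (TNCA scale)" using q that(2) by (auto simp: free_on_def)
    moreover have "([], []) \<in> gens (TNCA scale) \<times> gens (TNCA scale)" by (simp add: gens_TNCA)
    ultimately have "klin scale (\<lambda>a. \<beta> (bar_mult ([], []) (bar_mult (cop_NC_term (L, u @ a # v) Q) z)))"
      using \<beta> L that(1) unfolding mlin_def by blast
    then show ?thesis by (simp add: case_prod_unfold)
  qed
  then show ?thesis
    unfolding ev_mult_tensor \<delta> ev_sum ev_single mult_1 by (intro klin_sum klin_ev) auto
qed

text \<open>Induction on the letters in front of the varied one. Each of them moves into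
  \<open>\<beta>\<close> as a left factor, hence the generalisation over
  \<open>\<beta>\<close>.\<close>

lemma klin_cop_bar:
  fixes scale :: "'k::field_char_0 \<Rightarrow> 'a::{ring, monoid_mult} \<Rightarrow> 'a"
  assumes "mlin scale \<beta>" "p \<in> gens (TNCA scale)" "q \<in> gens (TNCA scale)"
    and L: "L \<in> NC (length u + Suc (length v))"
  shows "klin scale (\<lambda>a. ev \<beta> (cop_bar cop_NC (p @ (L, u @ a # v) # q)))"
  using assms(1,2)
proof (induction p arbitrary: \<beta>)
  case Nil
  have "cop_bar cop_NC q \<in> free_on (gens (TNCA scale) \<times> gens (TNCA scale))"
    unfolding gens_TNCA using cop_NC_free(1) assms(3)[unfolded gens_TNCA] by (rule free_on_cop_bar)
  then show ?case
    unfolding append_Nil cop_bar.simps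
    by (rule klin_letter[where C = "\<lambda>_. True", OF Nil(1) _ L]) (simp add: cop_NC_def[of "(_, _)"])
next
  case (Cons x p)
  then have x: "x \<in> gens (NCA scale)" and p: "p \<in> gens (TNCA scale)" by (simp_all add: gens_TNCA)
  have "z \<in> gens (TNCA scale) \<times> gens (TNCA scale)" if "z \<in> Poly_Mapping.keys (cop_NC x :: _ \<Rightarrow>\<^sub>0 'k)" for z
    using cop_NC_free(1)[OF x] that unfolding free_on_def gens_TNCA by blast
  then show ?case
    unfolding append_Cons cop_bar.simps ev_mult_tensor
    by (intro klin_ev Cons.IH mlin_bar_mult[OF Cons.prems(1)] p)
qed

lemma klin_cop_half:
  fixes scale :: "'k::field_char_0 \<Rightarrow> 'a::{ring, monoid_mult} \<Rightarrow> 'a"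
  assumes "mlin scale \<beta>" "p \<in> gens (TNCA scale)" "q \<in> gens (TNCA scale)"
    and L: "L \<in> NC (length u + Suc (length v))"
    and \<delta>: "\<And>L w. \<delta> (L, w) = (\<Sum>Q\<in>{Q. admissible L Q \<and> C L Q}. gen (cop_NC_term (L, w) Q))"
    and free: "\<And>x. x \<in> gens (NCA scale) \<Longrightarrow> (\<delta> x :: _ \<Rightarrow>\<^sub>0 'k)
      \<in> free_on (lists (gens (NCA scale)) \<times> lists (gens (NCA scale)))"
  shows "klin scale (\<lambda>a. ev \<beta> (cop_half \<delta> cop_NC (p @ (L, u @ a # v) # q)))"
proof (cases p)
  case Nil
  have "cop_bar cop_NC q \<in> free_on (gens (TNCA scale) \<times> gens (TNCA scale))"
    unfolding gens_TNCA using cop_NC_free(1) assms(3)[unfolded gens_TNCA] by (rule free_on_cop_bar)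
  then show ?thesis
    unfolding Nil append_Nil cop_half.simps by (rule klin_letter[where \<delta> = \<delta> and C = "C L", OF assms(1) _ L \<delta>])
next
  case (Cons x p')
  then have x: "x \<in> gens (NCA scale)" and p: "p' \<in> gens (TNCA scale)"
    using assms(2) by (simp_all add: gens_TNCA)
  have "z \<in> gens (TNCA scale) \<times> gens (TNCA scale)" if "z \<in> Poly_Mapping.keys (\<delta> x)" for z
    using free[OF x] that unfolding free_on_def gens_TNCA by blast
  then show ?thesis
    unfolding Cons append_Cons cop_half.simps ev_mult_tensor
    by (intro klin_ev klin_cop_bar mlin_bar_mult[OF assms(1)] p assms(3) L)
qed

section \<open>The dual of the splitting map\<close>

text \<open>The functional behind the left half-convolution respects the relations. In the reduced
  term the second leg is the unit, so it contributes a constant factor \<open>\<psi> []\<close> to a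
  linear expression.\<close>

lemma compatible_cop_prec:
  assumes "compatible (TNCA scale) \<phi>" "compatible (TNCA scale) \<psi>"
  shows "compatible (TNCA scale) (\<lambda>xs. ev (\<lambda>(x, y). \<phi> x * \<psi> y) (cop_prec cop_NC_prec cop_NC xs))"
proof -
  have "klin scale (\<lambda>a. ev (\<lambda>(x, y). \<phi> x * \<psi> y) (cop_half cop_NC_prec cop_NC (p @ (L, u @ a # v) # q))
      - \<phi> (p @ (L, u @ a # v) # q) * \<psi> [])"
    if "p \<in> gens (TNCA scale)" "q \<in> gens (TNCA scale)" "L \<in> NC (length u + Suc (length v))" for p q u v L
  proof (intro klin_diff klin_mult_right klin_cop_half[where C = "\<lambda>_ Q. \<exists>B\<in>Q. 1 \<in> B"]
      mlin_tensor assms that cop_NC_free)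
    show "klin scale (\<lambda>a. \<phi> (p @ (L, u @ a # v) # q))"
      using assms(1) that unfolding compatible_TNCA by blast
  qed (simp_all add: cop_NC_prec_def)
  then show ?thesis
    unfolding compatible_TNCA by (simp add: cop_prec_def ev_diff)
qed

lemma compatible_cop_succ:
  assumes "compatible (TNCA scale) \<phi>" "compatible (TNCA scale) \<psi>"
  shows "compatible (TNCA scale) (\<lambda>xs. ev (\<lambda>(x, y). \<phi> x * \<psi> y) (cop_succ cop_NC_succ cop_NC xs))"
proof -
  have "klin scale (\<lambda>a. ev (\<lambda>(x, y). \<phi> x * \<psi> y) (cop_half cop_NC_succ cop_NC (p @ (L, u @ a # v) # q))
      - \<phi> [] * \<psi> (p @ (L, u @ a # v) # q))"
    if "p \<in> gens (TNCA scale)" "q \<in> gens (TNCA scale)" "L \<in> NC (length u + Suc (length v))" for p q u v L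
  proof (intro klin_diff klin_mult_left klin_cop_half[where C = "\<lambda>L Q. \<exists>B\<in>L - Q. 1 \<in> B"]
      mlin_tensor assms that cop_NC_free)
    show "klin scale (\<lambda>a. \<psi> (p @ (L, u @ a # v) # q))"
      using assms(2) that unfolding compatible_TNCA by blast
  qed (simp_all add: cop_NC_succ_def)
  then show ?thesis
    unfolding compatible_TNCA by (simp add: cop_succ_def ev_diff)
qed

lemma Sp_eq:
  assumes "X \<in> qspace (TTA scale)"
  shows "Sp scale X = coset (TNCA scale) (lin_ext Sp_bar (rep (TTA scale) X))"
    and "lin_ext Sp_bar (rep (TTA scale) X) \<in> free_on (gens (TNCA scale))"
    and "Sp scale X \<in> qspace (TNCA scale)"
proof -
  show e: "Sp scale X = coset (TNCA scale) (lin_ext Sp_bar (rep (TTA scale) X))"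
    using assms by (simp add: Sp_def induced_def)
  show f: "lin_ext Sp_bar (rep (TTA scale) X) \<in> free_on (gens (TNCA scale))"
    by (rule free_on_lin_ext[OF rep_qspace(1)[OF assms] Sp_bar_free])
  show "Sp scale X \<in> qspace (TNCA scale)" unfolding e using f by (rule coset_in_qspace)
qed

abbreviation on_gens :: "('w, 'k::field_char_0) presentation \<Rightarrow> (('w \<Rightarrow>\<^sub>0 'k) set \<Rightarrow> 'k) \<Rightarrow> 'w \<Rightarrow> 'k" where
  "on_gens V f \<equiv> \<lambda>x. f (coset V (gen x))"

lemma Sp_dual_eq:
  assumes "f \<in> Lin (TNCA scale)"
  shows "Sp_dual scale f =
    (\<lambda>X\<in>qspace (TTA scale). ev (\<lambda>ws. ev (on_gens (TNCA scale) f) (Sp_bar ws)) (rep (TTA scale) X))"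
  unfolding Sp_dual_def
  by (rule restrict_ext) (simp add: Sp_eq Lin_coset_eq_ev[OF assms] ev_lin_ext)

lemma Sp_dual_compatible:
  assumes "f \<in> Lin (TNCA scale)"
  shows "compatible (TTA scale) (\<lambda>ws. ev (on_gens (TNCA scale) f) (Sp_bar ws))"
  by (rule compatible_Sp_bar[OF Lin_compatible[OF assms rels_TNCA_free]])

lemma Sp_dual_Lin:
  assumes "f \<in> Lin (TNCA scale)"
  shows "Sp_dual scale f \<in> Lin (TTA scale)"
  unfolding Sp_dual_eq[OF assms] by (rule ev_rep_in_Lin[OF Sp_dual_compatible[OF assms]])

lemma Sp_dual_gen:
  assumes "f \<in> Lin (TNCA scale)" "ws \<in> gens (TTA scale)"
  shows "Sp_dual scale f (coset (TTA scale) (gen ws)) = ev (on_gens (TNCA scale) f) (Sp_bar ws)"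
  using assms(2) ev_rep_coset[OF Sp_dual_compatible[OF assms(1)], of "gen ws"]
  by (simp add: Sp_dual_eq[OF assms(1)] coset_in_qspace)

lemma at_unit_Sp_dual:
  assumes "f \<in> Lin (TNCA scale)"
  shows "at_unit (TTA scale) (Sp_dual scale f) = at_unit (TNCA scale) f"
  unfolding at_unit_def using Sp_dual_gen[OF assms, of "[]"] by (simp add: gens_TTA)

lemma unit_fun_Sp:
  fixes scale :: "'k::field_char_0 \<Rightarrow> 'a::{ring, monoid_mult} \<Rightarrow> 'a"
  assumes "X \<in> qspace (TTA scale)"
  shows "unit_fun (TNCA scale) (Sp scale X) = unit_fun (TTA scale) X"
proof -
  let ?e = "\<lambda>xs. if xs = [] then 1 else 0"
  \<comment> \<open>Every word occurring in a relation contains the letter that is varied, so the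
    indicator of the empty bar word vanishes on relations.\<close>
  have "compatible (TNCA scale) ?e" by (simp add: compatible_TNCA klin_zero)
  then have "unit_fun (TNCA scale) (Sp scale X) = ev ?e (lin_ext Sp_bar (rep (TTA scale) X))"
    using Sp_eq[OF assms] by (simp add: unit_fun_def lookup_eq_ev ev_rep_coset coset_in_qspace)
  also have "\<dots> = ev (\<lambda>ws. Poly_Mapping.lookup (Sp_bar ws) []) (rep (TTA scale) X)"
    by (simp only: ev_lin_ext lookup_eq_ev)
  also have "\<dots> = ev ?e (rep (TTA scale) X)"
  proof (rule ev_cong)
    show "Poly_Mapping.lookup (Sp_bar ws :: _ \<Rightarrow>\<^sub>0 'k) [] = (if ws = [] then 1 else 0)"
      for ws :: "'a list list"
      using keys_Sp_bar_Nil[of ws] by (cases "ws = []") (simp_all add: in_keys_iff del: Sp_bar.simps(2))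
  qed
  finally show ?thesis using assms by (simp add: unit_fun_def lookup_eq_ev)
qed

text \<open>The part common to both half-convolutions. \<open>DD'\<close> is the intertwining of
  \<open>Sp\<close> with the coproducts in dual form; the other hypotheses make both sides
  computable on generators.\<close>

lemma tensor_fun_Sp:
  fixes scale :: "'k::field_char_0 \<Rightarrow> 'a::{ring, monoid_mult} \<Rightarrow> 'a"
  assumes f: "f \<in> Lin (TNCA scale)" and g: "g \<in> Lin (TNCA scale)" and X: "X \<in> qspace (TTA scale)"
    and compat: "compatible (TNCA scale)
      (\<lambda>xs. ev (\<lambda>(x, y). on_gens (TNCA scale) f x * on_gens (TNCA scale) g y) (D xs))"
    and D: "\<And>xs. xs \<in> gens (TNCA scale) \<Longrightarrow> D xs \<in> free_on (gens (TNCA scale) \<times> gens (TNCA scale))"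
    and D': "\<And>ws. ws \<in> gens (TTA scale) \<Longrightarrow> D' ws \<in> free_on (gens (TTA scale) \<times> gens (TTA scale))"
    and DD': "\<And>ws \<beta>. [] \<notin> set ws \<Longrightarrow> ev (\<lambda>xs. ev \<beta> (D xs)) (Sp_bar ws) = ev (Sp_tensor \<beta>) (D' ws :: _ \<Rightarrow>\<^sub>0 'k)"
  shows "tensor_fun (TNCA scale) (TNCA scale) f g
      (induced (TNCA scale) (tensor (TNCA scale) (TNCA scale)) D (Sp scale X))
    = tensor_fun (TTA scale) (TTA scale) (Sp_dual scale f) (Sp_dual scale g)
      (induced (TTA scale) (tensor (TTA scale) (TTA scale)) D' X)"
proof -
  let ?H = "TNCA scale" and ?H' = "TTA scale"
  let ?F = "on_gens ?H f" and ?G = "on_gens ?H g"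
  let ?F' = "on_gens ?H' (Sp_dual scale f)" and ?G' = "on_gens ?H' (Sp_dual scale g)"
  let ?\<beta> = "\<lambda>(x, y). ?F x * ?G y"
  let ?P = "lin_ext Sp_bar (rep ?H' X)" and ?Y = "Sp scale X"
  have "lin_ext D (rep ?H ?Y) \<in> free_on (gens ?H \<times> gens ?H)"
    using rep_qspace(1)[OF Sp_eq(3)[OF X]] D by (rule free_on_lin_ext)
  then have "tensor_fun ?H ?H f g (induced ?H (tensor ?H ?H) D ?Y) = ev ?\<beta> (lin_ext D (rep ?H ?Y))"
    unfolding induced_def using Sp_eq(3)[OF X]
    by (simp add: tensor_fun_coset Lin_compatible f g rels_TNCA_free)
  \<comment> \<open>Here the arbitrary representative of \<open>Sp X\<close> is exchanged for the
    explicit one, to which \<open>DD'\<close> applies; this is the use of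
    \<open>compat\<close>.\<close>
  also have "\<dots> = ev (\<lambda>xs. ev ?\<beta> (D xs)) ?P"
    unfolding ev_lin_ext[of ?\<beta>] Sp_eq(1)[OF X] by (rule ev_rep_coset[OF compat Sp_eq(2)[OF X]])
  also have "\<dots> = ev (\<lambda>ws. ev (\<lambda>(x, y). ?F' x * ?G' y) (D' ws)) (rep ?H' X)"
    unfolding ev_lin_ext
  proof (rule ev_cong)
    fix ws assume "ws \<in> Poly_Mapping.keys (rep ?H' X)"
    then have ws: "ws \<in> gens ?H'" using rep_qspace(1)[OF X] by (auto simp: free_on_def)
    have "Sp_tensor ?\<beta> z = (case z of (x, y) \<Rightarrow> ?F' x * ?G' y)" if "z \<in> Poly_Mapping.keys (D' ws)" for z
    proof -
      obtain x y where z: "z = (x, y)" "x \<in> gens ?H'" "y \<in> gens ?H'"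
        using D'[OF ws] \<open>z \<in> _\<close> by (auto simp: free_on_def)
      \<comment> \<open>A product functional pulled back along Sp \<otimes> Sp is the product of the
        two pullbacks.\<close>
      have "Sp_tensor ?\<beta> z = ev ?F (Sp_bar x) * ev ?G (Sp_bar y)"
        by (simp add: Sp_tensor_def z(1) ev_fun_mult ev_fun_mult_right)
      then show ?thesis by (simp add: z Sp_dual_gen f g)
    qed
    then have "ev (Sp_tensor ?\<beta>) (D' ws) = ev (\<lambda>(x, y). ?F' x * ?G' y) (D' ws)" by (rule ev_cong)
    moreover have "[] \<notin> set ws" using ws by (auto simp: gens_TTA gens_TA)
    ultimately show "ev (\<lambda>xs. ev ?\<beta> (D xs)) (Sp_bar ws) = ev (\<lambda>(x, y). ?F' x * ?G' y) (D' ws)"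
      using DD'[of ws ?\<beta>] by simp
  qed
  also have "\<dots> = ev (\<lambda>(x, y). ?F' x * ?G' y) (lin_ext D' (rep ?H' X))"
    by (rule ev_lin_ext[symmetric])
  also have "\<dots> = tensor_fun ?H' ?H' (Sp_dual scale f) (Sp_dual scale g) (induced ?H' (tensor ?H' ?H') D' X)"
  proof -
    have "lin_ext D' (rep ?H' X) \<in> free_on (gens ?H' \<times> gens ?H')"
      using rep_qspace(1)[OF X] D' by (rule free_on_lin_ext)
    then show ?thesis
      unfolding induced_def using X
      by (simp add: tensor_fun_coset Lin_compatible Sp_dual_Lin f g rels_TTA_free)
  qed
  finally show ?thesis .
qed

text \<open>Besides the reduced coproduct, \<open>half_prec\<close> contains the correction that
  encodes the conventions for \<open>e\<close>. It is preserved because \<open>Sp\<close> fixes the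
  empty bar word and the coefficient at it, by \<open>at_unit_Sp_dual\<close> and
  \<open>unit_fun_Sp\<close>.\<close>

lemma Sp_dual_prec:
  assumes f: "f \<in> Lin (TNCA scale)" and g: "g \<in> Lin (TNCA scale)"
  shows "Sp_dual scale (prec_NC scale f g) = prec_A scale (Sp_dual scale f) (Sp_dual scale g)"
proof -
  note Lin = Lin_compatible[OF _ rels_TNCA_free]
  have "Sp_dual scale (prec_NC scale f g) X = prec_A scale (Sp_dual scale f) (Sp_dual scale g) X"
    if X: "X \<in> qspace (TTA scale)" for X
  proof -
    have "tensor_fun (TNCA scale) (TNCA scale) f g
        (induced (TNCA scale) (tensor (TNCA scale) (TNCA scale)) (cop_prec cop_NC_prec cop_NC) (Sp scale X))
      = tensor_fun (TTA scale) (TTA scale) (Sp_dual scale f) (Sp_dual scale g)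
        (induced (TTA scale) (tensor (TTA scale) (TTA scale)) (cop_prec cop_A_prec cop_A) X)"
    proof (rule tensor_fun_Sp[OF f g X compatible_cop_prec[OF Lin[OF f] Lin[OF g]] _ _ Sp_tensor_cop_prec])
      show "cop_prec cop_NC_prec cop_NC xs \<in> free_on (gens (TNCA scale) \<times> gens (TNCA scale))"
        if "xs \<in> gens (TNCA scale)" for xs
        using that unfolding gens_TNCA by (intro free_on_cop_reduced cop_NC_free)
      show "cop_prec cop_A_prec cop_A ws \<in> free_on (gens (TTA scale) \<times> gens (TTA scale))"
        if "ws \<in> gens (TTA scale)" for ws
        using that unfolding gens_TTA by (intro free_on_cop_reduced cop_A_free)
    qed
    moreover have "Sp_dual scale f X = f (Sp scale X)" using X by (simp add: Sp_dual_def)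
    ultimately show ?thesis
      using X Sp_eq(3)[OF X] unfolding prec_NC_def prec_A_def half_prec_def
      by (simp add: Sp_dual_def[of _ "restrict _ _"] at_unit_Sp_dual f g unit_fun_Sp)
  qed
  then show ?thesis
    by (intro extensionalityI[of _ "qspace (TTA scale)"])
      (auto simp: Sp_dual_def prec_A_def half_prec_def)
qed

lemma Sp_dual_succ:
  assumes f: "f \<in> Lin (TNCA scale)" and g: "g \<in> Lin (TNCA scale)"
  shows "Sp_dual scale (succ_NC scale f g) = succ_A scale (Sp_dual scale f) (Sp_dual scale g)"
proof -
  note Lin = Lin_compatible[OF _ rels_TNCA_free]
  have "Sp_dual scale (succ_NC scale f g) X = succ_A scale (Sp_dual scale f) (Sp_dual scale g) X"
    if X: "X \<in> qspace (TTA scale)" for X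
  proof -
    have "tensor_fun (TNCA scale) (TNCA scale) f g
        (induced (TNCA scale) (tensor (TNCA scale) (TNCA scale)) (cop_succ cop_NC_succ cop_NC) (Sp scale X))
      = tensor_fun (TTA scale) (TTA scale) (Sp_dual scale f) (Sp_dual scale g)
        (induced (TTA scale) (tensor (TTA scale) (TTA scale)) (cop_succ cop_A_succ cop_A) X)"
    proof (rule tensor_fun_Sp[OF f g X compatible_cop_succ[OF Lin[OF f] Lin[OF g]] _ _ Sp_tensor_cop_succ])
      show "cop_succ cop_NC_succ cop_NC xs \<in> free_on (gens (TNCA scale) \<times> gens (TNCA scale))"
        if "xs \<in> gens (TNCA scale)" for xs
        using that unfolding gens_TNCA by (intro free_on_cop_reduced cop_NC_free)
      show "cop_succ cop_A_succ cop_A ws \<in> free_on (gens (TTA scale) \<times> gens (TTA scale))"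
        if "ws \<in> gens (TTA scale)" for ws
        using that unfolding gens_TTA by (intro free_on_cop_reduced cop_A_free)
    qed
    moreover have "Sp_dual scale g X = g (Sp scale X)" using X by (simp add: Sp_dual_def)
    ultimately show ?thesis
      using X Sp_eq(3)[OF X] unfolding succ_NC_def succ_A_def half_succ_def
      by (simp add: Sp_dual_def[of _ "restrict _ _"] at_unit_Sp_dual f g unit_fun_Sp)
  qed
  then show ?thesis
    by (intro extensionalityI[of _ "qspace (TTA scale)"])
      (auto simp: Sp_dual_def succ_A_def half_succ_def)
qed

theorem mainTheorem5:
  fixes scale :: "'k::field_char_0 \<Rightarrow> 'a::{ring, monoid_mult} \<Rightarrow> 'a"
  assumes "unital_algebra scale"
  shows "Sp_dual scale \<in> Lin (TNCA scale) \<rightarrow> Lin (TTA scale)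
    \<and> (\<forall>f\<in>Lin (TNCA scale). \<forall>g\<in>Lin (TNCA scale).
         Sp_dual scale (lin_add (TNCA scale) f g)
           = lin_add (TTA scale) (Sp_dual scale f) (Sp_dual scale g))
    \<and> (\<forall>c. \<forall>f\<in>Lin (TNCA scale).
         Sp_dual scale (lin_smul (TNCA scale) c f) = lin_smul (TTA scale) c (Sp_dual scale f))
    \<and> (\<forall>f\<in>Lin (TNCA scale). \<forall>g\<in>Lin (TNCA scale).
         Sp_dual scale (prec_NC scale f g)
           = prec_A scale (Sp_dual scale f) (Sp_dual scale g))
    \<and> (\<forall>f\<in>Lin (TNCA scale). \<forall>g\<in>Lin (TNCA scale).
         Sp_dual scale (succ_NC scale f g)
           = succ_A scale (Sp_dual scale f) (Sp_dual scale g))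
    \<and> Sp_dual scale (unit_fun (TNCA scale)) = unit_fun (TTA scale)"
proof (intro conjI ballI allI)
  show "Sp_dual scale \<in> Lin (TNCA scale) \<rightarrow> Lin (TTA scale)"
    using Sp_dual_Lin by blast
  \<comment> \<open>The vector space operations on functionals are pointwise on the quotient, so it
    is enough that \<open>Sp X\<close> lies in the quotient space.\<close>
  show "Sp_dual scale (lin_add (TNCA scale) f g) = lin_add (TTA scale) (Sp_dual scale f) (Sp_dual scale g)"
    for f g :: "_ \<Rightarrow> 'k"
    unfolding Sp_dual_def lin_add_def by (rule restrict_ext) (simp add: Sp_eq(3))
  show "Sp_dual scale (lin_smul (TNCA scale) c f) = lin_smul (TTA scale) c (Sp_dual scale f)"
    for c and f :: "_ \<Rightarrow> 'k"
    unfolding Sp_dual_def lin_smul_def by (rule restrict_ext) (simp add: Sp_eq(3))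
  show "Sp_dual scale (unit_fun (TNCA scale)) = unit_fun (TTA scale)"
    by (rule extensionalityI[of _ "qspace (TTA scale)"])
      (auto simp: Sp_dual_def unit_fun_Sp, simp add: unit_fun_def)
qed (simp_all add: Sp_dual_prec Sp_dual_succ)

end
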